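(* Let $G$ be a simple graph on $n$ vertices with maximum degree $\Delta(G)$ and minimum degree $\delta(G)$, and suppose $G$ is $\Delta$-critical. If $\Delta(G)-\frac{5\delta(G)}{3}\ge\frac{2n-7}{3}$, then $G$ is overfull, i.e. $|E(G)|>\Delta(G)\lfloor n/2\rfloor$.
   Context: All graphs are finite, simple and connected. The chromatic index $\chi'(G)$ is the least $k$ such that $G$ has a proper $k$-edge-coloring (adjacent edges get distinct colors). A graph $G$ is $\Delta$-critical if $\chi'(G)=\Delta(G)+1$ and $\chi'(H)<\chi'(G)$ for every proper subgraph $H$ of $G$. A graph $G$ on $n$ vertices is overfull if $|E(G)|>\Delta(G)\lfloor n/2\rfloor$. *)

theory Defs
  imports Complex_Main
begin

text \<open>A graph is a vertex set \<open>V\<close> together with a set \<open>E\<close> of edges, each edge being a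
  two-element set of vertices.\<close>

definition simple_graph :: "'a set \<Rightarrow> 'a set set \<Rightarrow> bool" where
  "simple_graph V E \<longleftrightarrow> finite V \<and> (\<forall>e\<in>E. e \<subseteq> V \<and> card e = 2)"

definition connected_graph :: "'a set \<Rightarrow> 'a set set \<Rightarrow> bool" where
  "connected_graph V E \<longleftrightarrow>
     V \<noteq> {} \<and> (\<forall>u\<in>V. \<forall>v\<in>V. (u, v) \<in> {(x, y). {x, y} \<in> E}\<^sup>*)"

definition vertex_degree :: "'a set set \<Rightarrow> 'a \<Rightarrow> nat" where
  "vertex_degree E v = card {e \<in> E. v \<in> e}"

definition max_degree :: "'a set \<Rightarrow> 'a set set \<Rightarrow> nat" where
  "max_degree V E = Max (vertex_degree E ` V)"

definition min_degree :: "'a set \<Rightarrow> 'a set set \<Rightarrow> nat" where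
  "min_degree V E = Min (vertex_degree E ` V)"

definition proper_edge_coloring :: "'a set set \<Rightarrow> nat \<Rightarrow> ('a set \<Rightarrow> nat) \<Rightarrow> bool" where
  "proper_edge_coloring E k c \<longleftrightarrow>
     (\<forall>e\<in>E. c e < k) \<and>
     (\<forall>e\<in>E. \<forall>f\<in>E. e \<noteq> f \<and> e \<inter> f \<noteq> {} \<longrightarrow> c e \<noteq> c f)"

text \<open>Isolated vertices play no role here, so the chromatic index is a function of the edge set.\<close>

definition chromatic_index :: "'a set set \<Rightarrow> nat" where
  "chromatic_index E = (LEAST k. \<exists>c. proper_edge_coloring E k c)"

definition proper_subgraph ::
    "'a set \<Rightarrow> 'a set set \<Rightarrow> 'a set \<Rightarrow> 'a set set \<Rightarrow> bool" where
  "proper_subgraph W F V E \<longleftrightarrow>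
     simple_graph W F \<and> W \<subseteq> V \<and> F \<subseteq> E \<and> (W \<noteq> V \<or> F \<noteq> E)"

text \<open>Subgraphs are not required to be connected. For connected \<open>V\<close>, \<open>E\<close> this makes no
  difference: the chromatic index of a graph with an edge is attained on one of its components,
  and an edgeless graph has chromatic index 0.\<close>

definition delta_critical :: "'a set \<Rightarrow> 'a set set \<Rightarrow> bool" where
  "delta_critical V E \<longleftrightarrow>
     chromatic_index E = max_degree V E + 1 \<and>
     (\<forall>W F. proper_subgraph W F V E \<longrightarrow> chromatic_index F < chromatic_index E)"

definition overfull :: "'a set \<Rightarrow> 'a set set \<Rightarrow> bool" where
  "overfull V E \<longleftrightarrow> card E > max_degree V E * (card V div 2)"

end

theory Submission
  imports Defs "HOL-Library.Multiset"
begin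

text \<open>Write \<open>\<Delta>\<close> for the maximum degree, let \<open>r\<close> be a vertex of minimum degree and \<open>s\<close> a
  neighbour of \<open>r\<close>, and colour \<open>G - rs\<close> with \<open>\<Delta>\<close> colours. It suffices that no colour is missing at two vertices: then every colour
  class has at least \<open>\<lfloor>n/2\<rfloor>\<close> edges, and \<open>rs\<close> is one more edge. Let \<open>R\<close> be the set of the
  \<open>\<Delta> - \<delta> + 1\<close> colours missing at \<open>r\<close>. If two vertices miss the same colour, then Kempe changes
  lead to a third vertex \<open>v\<close> missing a colour \<open>x\<close> that is missing at \<open>s\<close>. The hypothesis says
  that \<open>R\<close> is so large that two vertices which see all of \<open>R\<close> have more than \<open>|R|/2\<close> common
  neighbours along \<open>R\<close>-coloured edges. Hence there are common neighbours \<open>u\<close>, \<open>w\<close> of \<open>s\<close>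
  and \<open>v\<close> for which \<open>sw\<close> and \<open>uv\<close> have the same colour, and this configuration is reducible. If
  \<open>v\<close> misses colours of \<open>R\<close>, then a reducible path shows that \<open>v\<close> has small degree, and the
  argument is applied to \<open>s\<close> and a neighbour \<open>y\<close> of \<open>v\<close> after uncolouring \<open>vy\<close>.

  Reducibility of the three configurations is a finite game: the edges of the configuration are
  uncoloured, an opponent announces how the ends of the Kempe chains at its vertices are joined,
  and we swap chains until the configuration can be coloured. Winning strategies were found by a
  computer search and are checked by rewriting.\<close>

section \<open>Kempe changes\<close>

definition graph :: "'a set set \<Rightarrow> bool" where
  "graph F \<longleftrightarrow> finite F \<and> (\<forall>e\<in>F. card e = 2)"

definition sees :: "'a set set \<Rightarrow> ('a set \<Rightarrow> nat) \<Rightarrow> 'a \<Rightarrow> nat \<Rightarrow> bool" where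
  "sees F c v x \<longleftrightarrow> (\<exists>e\<in>F. v \<in> e \<and> c e = x)"

definition bicol :: "'a set set \<Rightarrow> ('a set \<Rightarrow> nat) \<Rightarrow> nat \<Rightarrow> nat \<Rightarrow> 'a set set" where
  "bicol F c x y = {e \<in> F. c e = x \<or> c e = y}"

definition linked :: "'a set set \<Rightarrow> ('a \<times> 'a) set" where
  "linked U = {(u, w). {u, w} \<in> U}\<^sup>*"

definition endpt :: "'a set set \<Rightarrow> 'a \<Rightarrow> bool" where
  "endpt U v \<longleftrightarrow> card {e \<in> U. v \<in> e} = 1"

definition saturated :: "'a set set \<Rightarrow> 'a set \<Rightarrow> bool" where
  "saturated U Z \<longleftrightarrow> (\<forall>e\<in>U. e \<inter> Z \<noteq> {} \<longrightarrow> e \<subseteq> Z)"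

text \<open>Swaps are indexed by vertex sets. They are Kempe changes when \<open>Z\<close> is
  \<open>saturated\<close> for the two colours, and \<open>Z\<close> may collect several
  chains.\<close>

definition kempe :: "'a set \<Rightarrow> nat \<Rightarrow> nat \<Rightarrow> ('a set \<Rightarrow> nat) \<Rightarrow> 'a set \<Rightarrow> nat" where
  "kempe Z x y c e =
     (if e \<subseteq> Z then (if c e = x then y else if c e = y then x else c e) else c e)"

lemma graph_subset: "graph F \<Longrightarrow> F' \<subseteq> F \<Longrightarrow> graph F'"
  unfolding graph_def using finite_subset by blast

lemma graph_edge:
  assumes "graph F" "e \<in> F" "v \<in> e"
  obtains w where "e = {v, w}" "w \<noteq> v"
proof -
  have "card e = 2" using assms unfolding graph_def by blast
  then obtain a b where ab: "e = {a, b}" "a \<noteq> b" by (meson card_2_iff)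
  then show thesis using assms(3) that[of a] that[of b] by auto
qed

lemma linked_sym: "(u, w) \<in> linked U \<Longrightarrow> (w, u) \<in> linked U"
proof -
  have "sym {(u, w). {u, w} \<in> U}" by (auto simp: sym_def insert_commute)
  then show "(u, w) \<in> linked U \<Longrightarrow> (w, u) \<in> linked U"
    unfolding linked_def by (metis sym_rtrancl symD)
qed

lemma linked_refl [simp]: "(u, u) \<in> linked U"
  unfolding linked_def by simp

lemma linked_trans: "(u, w) \<in> linked U \<Longrightarrow> (w, z) \<in> linked U \<Longrightarrow> (u, z) \<in> linked U"
  unfolding linked_def by (rule rtrancl_trans)

lemma saturated_linked:
  assumes "graph U"
  shows "saturated U (linked U `` A)"
  unfolding saturated_def
proof (intro ballI impI subsetI)
  fix e w assume e: "e \<in> U" "e \<inter> linked U `` A \<noteq> {}" "w \<in> e"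
  then obtain v a where v: "v \<in> e" "a \<in> A" "(a, v) \<in> linked U" by blast
  obtain v' where "e = {v, v'}" using graph_edge[OF assms e(1) v(1)] by blast
  then have "(v, w) \<in> linked U"
    using e v unfolding linked_def by auto
  then show "w \<in> linked U `` A" using v linked_trans by fast
qed

text \<open>A component of a graph of maximum degree 2 is a path or a cycle. The induction removes the
  edge at one end of the path, which turns the neighbouring vertex into the new end.\<close>

lemma at_most_two_ends:
  assumes "graph U" "\<And>v. card {e \<in> U. v \<in> e} \<le> 2"
    and "endpt U a" "endpt U p" "endpt U q" "a \<noteq> p" "a \<noteq> q" "p \<noteq> q"
    and "(a, p) \<in> linked U" "(a, q) \<in> linked U"
  shows False
  using assms
proof (induction "card U" arbitrary: U a rule: less_induct)
  case less
  have fin: "finite U" using less.prems unfolding graph_def by blast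
  obtain e where e: "{e \<in> U. a \<in> e} = {e}"
    using less.prems(3) unfolding endpt_def by (meson card_1_singletonE)
  then have eU: "e \<in> U" "a \<in> e" by auto
  obtain b where b: "e = {a, b}" "b \<noteq> a" using graph_edge[OF less.prems(1) eU] by blast
  define U' where "U' = U - {e}"
  have degU': "{f \<in> U. v \<in> f} = (if v = a \<or> v = b then insert e {f \<in> U'. v \<in> f} else {f \<in> U'. v \<in> f})" for v
    using b eU unfolding U'_def by auto
  have fin': "finite {f \<in> U'. v \<in> f}" and notin: "e \<notin> {f \<in> U'. v \<in> f}" for v
    using fin unfolding U'_def by auto
  have deg': "card {f \<in> U. v \<in> f} =
      (if v = a \<or> v = b then Suc (card {f \<in> U'. v \<in> f}) else card {f \<in> U'. v \<in> f})" for v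
    unfolding degU'[of v] using card_insert_disjoint[OF fin'[of v] notin[of v]] by (simp only: if_distrib if_cancel split: if_split) blast
  \<comment> \<open>Deleting the only edge \<open>e\<close> at \<open>a\<close> cuts no other vertex
    off from \<open>b\<close>: a walk to \<open>a\<close> must arrive through \<open>e\<close>,
    hence through \<open>b\<close>.\<close>
  have reach: "x = a \<or> (x, b) \<in> linked U'" if "(x, a) \<in> linked U" for x
    using that unfolding linked_def
  proof (induction rule: converse_rtrancl_induct)
    case base then show ?case by simp
  next
    case (step x z)
    then have xz: "{x, z} \<in> U" by simp
    show ?case
    proof (cases "{x, z} = e")
      case True
      then show ?thesis using b by (auto simp: doubleton_eq_iff)
    next
      case False
      then have "(x, z) \<in> {(u, w). {u, w} \<in> U'}" using xz unfolding U'_def by simp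
      moreover have "a \<noteq> z"
      proof
        assume "a = z"
        then have "{x, z} \<in> {e \<in> U. a \<in> e}" using xz by simp
        then show False using False unfolding e by simp
      qed
      ultimately show ?thesis
        using step.IH converse_rtrancl_into_rtrancl[of x z "{(u, w). {u, w} \<in> U'}" b] by (elim disjE) simp_all
    qed
  qed
  have pb: "(p, b) \<in> linked U'" "(q, b) \<in> linked U'"
    using reach[of p] reach[of q] linked_sym[OF less.prems(9)] linked_sym[OF less.prems(10)]
      less.prems(6,7) by blast+
  have nontriv: "\<exists>f\<in>U'. x \<in> f" if "(x, y) \<in> linked U'" "x \<noteq> y" for x y
    using that unfolding linked_def by (metis (no_types, lifting) case_prodD converse_rtranclE insertI1 mem_Collect_eq)
  have ends: "b \<noteq> x" "endpt U' x" if x: "endpt U x" "x \<noteq> a" "(x, b) \<in> linked U'" "(y, b) \<in> linked U'" "x \<noteq> y" for x y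
  proof -
    \<comment> \<open>If the end \<open>x\<close> were \<open>b\<close>, its only edge would be the
      deleted one, and it could not be linked to \<open>y\<close> in \<open>U'\<close>.\<close>
    show "b \<noteq> x"
    proof
      assume bx: "b = x"
      then have "(x, y) \<in> linked U'" using x linked_sym by fast
      then have "\<exists>f\<in>U'. x \<in> f" using nontriv x by blast
      then have "card {f \<in> U'. x \<in> f} \<noteq> 0" using fin' by auto
      then show False using x(1) deg'[of x] bx unfolding endpt_def by auto
    qed
    then show "endpt U' x" using x deg'[of x] unfolding endpt_def by auto
  qed
  have bp: "b \<noteq> p" "endpt U' p" using ends[of p q] less.prems pb by auto
  have bq: "b \<noteq> q" "endpt U' q" using ends[of q p] less.prems pb by auto
  have "\<exists>f\<in>U'. b \<in> f" using nontriv[of b p] linked_sym[OF pb(1)] bp by blast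
  then have "card {f \<in> U'. b \<in> f} \<noteq> 0" using fin' by auto
  then have bend: "endpt U' b" using deg'[of b] less.prems(2)[of b] unfolding endpt_def by auto
  have "card U' < card U" unfolding U'_def using fin eU(1) by (rule card_Diff1_less)
  moreover have "graph U'" using graph_subset[OF less.prems(1)] unfolding U'_def by blast
  moreover have "card {f \<in> U'. v \<in> f} \<le> 2" for v using deg'[of v] less.prems(2)[of v] by (auto split: if_splits)
  ultimately show False
    using less.hyps[of U' b] bend bp bq less.prems(8) linked_sym[OF pb(1)] linked_sym[OF pb(2)] by blast
qed

section \<open>The subgraph of two colours\<close>

lemma proper_unique:
  assumes "proper_edge_coloring F k c" "e \<in> F" "f \<in> F" "v \<in> e" "v \<in> f" "c e = c f"
  shows "e = f"
  using assms unfolding proper_edge_coloring_def by blast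

lemma card_color_at:
  assumes "proper_edge_coloring F k c" "finite F"
  shows "card {e \<in> F. v \<in> e \<and> c e = x} = (if sees F c v x then 1 else 0)"
proof (cases "sees F c v x")
  case True
  then obtain e where e: "e \<in> F" "v \<in> e" "c e = x" unfolding sees_def by blast
  then have "{e \<in> F. v \<in> e \<and> c e = x} = {e}" using proper_unique[OF assms(1)] by blast
  then show ?thesis using True by simp
next
  case False
  then have "{e \<in> F. v \<in> e \<and> c e = x} = {}" unfolding sees_def by blast
  then show ?thesis using False by (metis card.empty)
qed

lemma card_bicol:
  assumes "proper_edge_coloring F k c" "finite F" "x \<noteq> y"
  shows "card {e \<in> bicol F c x y. v \<in> e} =
    (if sees F c v x then 1 else 0) + (if sees F c v y then 1 else 0)"
proof -
  have "{e \<in> bicol F c x y. v \<in> e} = {e \<in> F. v \<in> e \<and> c e = x} \<union> {e \<in> F. v \<in> e \<and> c e = y}"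
    unfolding bicol_def by blast
  moreover have "{e \<in> F. v \<in> e \<and> c e = x} \<inter> {e \<in> F. v \<in> e \<and> c e = y} = {}" using assms(3) by blast
  ultimately show ?thesis using card_color_at[OF assms(1,2), of v] assms(2)
    by (simp add: card_Un_disjoint)
qed

lemma endpt_bicol:
  assumes "proper_edge_coloring F k c" "finite F" "x \<noteq> y"
  shows "endpt (bicol F c x y) v \<longleftrightarrow> (sees F c v x \<noteq> sees F c v y)"
  unfolding endpt_def card_bicol[OF assms] by simp

lemma graph_bicol: "graph F \<Longrightarrow> graph (bicol F c x y)"
  by (rule graph_subset) (auto simp: bicol_def)

lemma two_ends_bicol:
  assumes "graph F" "proper_edge_coloring F k c" "x \<noteq> y"
    and "sees F c a x \<noteq> sees F c a y" "sees F c p x \<noteq> sees F c p y" "sees F c q x \<noteq> sees F c q y"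
    and "a \<noteq> p" "a \<noteq> q" "p \<noteq> q"
    and "(a, p) \<in> linked (bicol F c x y)" "(a, q) \<in> linked (bicol F c x y)"
  shows False
proof -
  have fin: "finite F" using assms(1) unfolding graph_def by blast
  have deg: "card {e \<in> bicol F c x y. v \<in> e} \<le> 2" for v
    unfolding card_bicol[OF assms(2) fin assms(3)] by simp
  have ends: "endpt (bicol F c x y) a" "endpt (bicol F c x y) p" "endpt (bicol F c x y) q"
    unfolding endpt_bicol[OF assms(2) fin assms(3)] by fact+
  show False
    by (rule at_most_two_ends[OF graph_bicol[OF assms(1)] deg ends assms(7-11)])
qed

text \<open>Edges of colour \<open>x\<close> or \<open>y\<close> do not leave a saturated set, so
  the effect of the swap on an edge can be read off at either of its ends. Properness and missing
  colours are then checked vertex by vertex.\<close>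

lemma kempe_at:
  assumes "saturated (bicol F c x y) Z" "e \<in> F" "v \<in> e"
  shows "kempe Z x y c e = (if v \<in> Z then (if c e = x then y else if c e = y then x else c e) else c e)"
  using assms unfolding kempe_def saturated_def bicol_def by auto

lemma kempe_proper:
  assumes "proper_edge_coloring F k c" "x < k" "y < k" "saturated (bicol F c x y) Z"
  shows "proper_edge_coloring F k (kempe Z x y c)"
proof -
  have "kempe Z x y c e < k" if "e \<in> F" for e
    using that assms unfolding kempe_def proper_edge_coloring_def by auto
  moreover have "kempe Z x y c e \<noteq> kempe Z x y c f"
    if ef: "e \<in> F" "f \<in> F" "e \<noteq> f" "e \<inter> f \<noteq> {}" for e f
  proof -
    obtain v where v: "v \<in> e" "v \<in> f" using ef by blast
    have "c e \<noteq> c f" using ef assms(1) unfolding proper_edge_coloring_def by blast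
    then show ?thesis using kempe_at[OF assms(4) ef(1) v(1)] kempe_at[OF assms(4) ef(2) v(2)]
      by (auto split: if_splits)
  qed
  ultimately show ?thesis unfolding proper_edge_coloring_def by blast
qed

lemma kempe_sees:
  assumes "saturated (bicol F c x y) Z"
  shows "sees F (kempe Z x y c) v z \<longleftrightarrow>
    sees F c v (if v \<in> Z then (if z = x then y else if z = y then x else z) else z)"
  unfolding sees_def using kempe_at[OF assms] by (auto split: if_splits)

lemma kempe_bicol:
  assumes "z \<noteq> x" "z \<noteq> y" "w \<noteq> x" "w \<noteq> y"
  shows "bicol F (kempe Z x y c) z w = bicol F c z w"
  using assms unfolding bicol_def kempe_def by auto

section \<open>The recolouring game\<close>

text \<open>A position is a list of columns, one for each of the colours in play. A column marks those
  vertices of the configuration at which its colour may occur on an edge outside the configuration.\<close>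

fun place :: "nat \<Rightarrow> nat \<Rightarrow> bool list list \<Rightarrow> bool list list list" where
  "place i j [] = []"
| "place i j (m # ms) =
    (if m ! i then [] else if m ! j then [] else [m[i := True, j := True] # ms])
      @ map ((#) m) (place i j ms)"

fun some_list :: "('b \<Rightarrow> bool) \<Rightarrow> 'b list \<Rightarrow> bool" where
  "some_list P [] = False"
| "some_list P (x # xs) = (if P x then True else some_list P xs)"

lemma some_list_iff: "some_list P xs \<longleftrightarrow> (\<exists>x\<in>set xs. P x)"
  by (induction xs) auto

fun colourable :: "(nat \<times> nat) list \<Rightarrow> bool list list \<Rightarrow> bool" where
  "colourable [] ms = True"
| "colourable ((i, j) # es) ms = some_list (colourable es) (place i j ms)"

text \<open>Addition of masks over the field of two elements. Where two columns differ, exchanging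
  them negates both entries, so swapping chains adds one mask to both columns.\<close>

definition flip :: "bool list \<Rightarrow> bool list \<Rightarrow> bool list" where
  "flip = map2 (\<noteq>)"

text \<open>Applied to the sum of two columns, this lists the possible chain ends as singleton
  masks.\<close>

fun units :: "bool list \<Rightarrow> bool list list" where
  "units [] = []"
| "units (b # bs) =
    (if b then [True # replicate (length bs) False] else []) @ map ((#) False) (units bs)"

text \<open>\<open>ask t k us L\<close> branches over the partner of the first chain end in \<open>L\<close>, which is either
  another end in \<open>L\<close> or outside the configuration. The list \<open>us\<close> holds the unions of the chains known
  so far, \<open>t\<close> tests whether swapping on such a union wins, and \<open>k\<close> is consulted when all ends are
  paired up. The conditionals keep evaluation by rewriting lazy.\<close>

function ask :: "(bool list \<Rightarrow> bool) \<Rightarrow> (bool list list \<Rightarrow> bool) \<Rightarrow> bool list list \<Rightarrow> bool list list \<Rightarrow> bool" where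
  "ask t k us [] = k us"
| "ask t k us (i # L) =
    list_all (\<lambda>(g, L'). if some_list (\<lambda>u. t (flip g u)) us then True
                          else ask t k (us @ map (flip g) us) L')
      ((i, L) # map (\<lambda>j. (flip i j, remove1 j L)) L)"
  by pat_completeness auto
termination
  by (relation "measure (\<lambda>(t, k, us, L). length L)") (auto simp: length_remove1)

fun lex_le :: "bool list \<Rightarrow> bool list \<Rightarrow> bool" where
  "lex_le (a # as) (b # bs) = (if a = b then lex_le as bs else b)"
| "lex_le _ _ = True"

fun ins :: "bool list \<Rightarrow> bool list list \<Rightarrow> bool list list" where
  "ins x [] = [x]"
| "ins x (y # ys) = (if lex_le x y then x # y # ys else y # ins x ys)"

text \<open>Colours can be permuted, so only the multiset of columns matters. Sorting turns the
  search in a table into a test for equality.\<close>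

definition canon :: "bool list list \<Rightarrow> bool list list" where
  "canon ms = foldr ins ms []"

text \<open>\<open>tab\<close> holds positions already refuted; reaching one of them wins just as
  colouring the configuration does.\<close>

definition good :: "(nat \<times> nat) list \<Rightarrow> bool list list list \<Rightarrow> bool list list \<Rightarrow> bool" where
  "good es tab ms = (if colourable es ms then True else some_list ((=) (canon ms)) tab)"

text \<open>A row marked \<open>False\<close> queries the chains of its first two colours. A row marked \<open>True\<close> queries
  those of its first two and of its next two colours at once, which is possible because swapping
  one pair of colours does not change the chains of the other pair.\<close>

fun beats :: "(nat \<times> nat) list \<Rightarrow> bool list list list \<Rightarrow> bool \<times> bool list list \<Rightarrow> bool" where
  "beats es tab (False, x # y # ms) =
     ask (\<lambda>m. good es tab (flip m x # flip m y # ms)) (\<lambda>_. False)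
       [replicate (length x) False] (units (flip x y))"
| "beats es tab (True, x # y # z # w # ms) =
     ask (\<lambda>m. good es tab (flip m x # flip m y # z # w # ms))
       (\<lambda>us. ask (\<lambda>m'. some_list (\<lambda>m. good es tab (flip m x # flip m y # flip m' z # flip m' w # ms)) us)
         (\<lambda>_. False) [replicate (length x) False] (units (flip z w)))
       [replicate (length x) False] (units (flip x y))"
| "beats es tab _ = False"

fun check :: "(nat \<times> nat) list \<Rightarrow> bool list list list \<Rightarrow> (bool \<times> bool list list) list \<Rightarrow> bool" where
  "check es tab [] = True"
| "check es tab (p # ps) = (if beats es tab p then check es (canon (snd p) # tab) ps else False)"

fun bits :: "nat \<Rightarrow> int \<Rightarrow> bool list" where
  "bits 0 k = []"
| "bits (Suc n) k = (k mod 2 = 1) # bits n (k div 2)"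

text \<open>Columns are written as binary numbers, bit \<open>i\<close> standing for vertex \<open>i\<close>.\<close>

definition rows :: "nat \<Rightarrow> (bool \<times> int list) list \<Rightarrow> (bool \<times> bool list list) list" where
  "rows n = map (\<lambda>(b, ks). (b, map (bits n) ks))"

section \<open>Soundness of the game\<close>

text \<open>Marks bound the vertices that see the colour from above; only an unmarked entry carries
  information. One position thus stands for many colourings, all of which are refuted with
  it.\<close>

definition covers :: "'a set set \<Rightarrow> ('a set \<Rightarrow> nat) \<Rightarrow> 'a list \<Rightarrow> nat \<Rightarrow> bool list \<Rightarrow> bool" where
  "covers F c vs x m \<longleftrightarrow>
     length m = length vs \<and> (\<forall>i<length vs. sees F c (vs ! i) x \<longrightarrow> m ! i)"

definition realizable :: "'a set set \<Rightarrow> nat \<Rightarrow> 'a list \<Rightarrow> bool list list \<Rightarrow> bool" where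
  "realizable F k vs ms \<longleftrightarrow>
     (\<exists>c xs. proper_edge_coloring F k c \<and> distinct xs \<and> set xs \<subseteq> {..<k} \<and>
       list_all2 (covers F c vs) xs ms)"

lemma realizable_mset:
  assumes "realizable F k vs ms" "mset ms' = mset ms"
  shows "realizable F k vs ms'"
proof -
  obtain c xs where c: "proper_edge_coloring F k c" "distinct xs" "set xs \<subseteq> {..<k}"
    "list_all2 (covers F c vs) xs ms"
    using assms(1) unfolding realizable_def by blast
  have "list_all2 (\<lambda>m x. covers F c vs x m) ms xs"
    using c(4) by (simp add: list_all2_conv_all_nth)
  from list_all2_reorder_left_invariance[OF this assms(2)]
  obtain xs' where "list_all2 (\<lambda>m x. covers F c vs x m) ms' xs'" and m: "mset xs' = mset xs"
    by blast
  then have xs': "list_all2 (covers F c vs) xs' ms'" "mset xs' = mset xs"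
    by (simp_all add: list_all2_conv_all_nth)
  have "distinct xs'" "set xs' = set xs"
    using xs'(2) c(2) by (metis mset_eq_imp_distinct_iff, metis mset_eq_setD)
  then show ?thesis using c(1,3) xs'(1) unfolding realizable_def by metis
qed

lemma mset_canon: "mset (canon ms) = mset ms"
proof -
  have "mset (ins x ys) = add_mset x (mset ys)" for x ys
    by (induction ys) auto
  then show ?thesis unfolding canon_def by (induction ms) auto
qed

lemma place_nth:
  assumes "ms' \<in> set (place i j ms)"
  shows "\<exists>p<length ms. \<not> ms ! p ! i \<and> \<not> ms ! p ! j \<and> ms' = ms[p := (ms ! p)[i := True, j := True]]"
  using assms
proof (induction ms arbitrary: ms')
  case Nil
  then show ?case by simp
next
  case (Cons m ms)
  then consider "\<not> m ! i" "\<not> m ! j" "ms' = m[i := True, j := True] # ms"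
    | ms'' where "ms'' \<in> set (place i j ms)" "ms' = m # ms''"
    by (auto split: if_splits)
  then show ?case
  proof cases
    case 1
    then show ?thesis by (intro exI[of _ 0]) auto
  next
    case 2
    then obtain p where p: "p < length ms" "\<not> ms ! p ! i" "\<not> ms ! p ! j"
      "ms'' = ms[p := (ms ! p)[i := True, j := True]]"
      using Cons.IH by blast
    then show ?thesis using 2 by (intro exI[of _ "Suc p"]) auto
  qed
qed

lemma proper_insert:
  assumes "proper_edge_coloring F k c" "x < k" "\<not> sees F c v x" "\<not> sees F c w x"
  shows "proper_edge_coloring (insert {v, w} F) k (c({v, w} := x))"
  using assms unfolding proper_edge_coloring_def sees_def by auto

lemma nth_two_updates:
  "l < length m \<Longrightarrow> m[i := True, j := True] ! l \<longleftrightarrow> l = i \<or> l = j \<or> m ! l"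
  by (cases "l = j"; cases "l = i") simp_all

text \<open>By induction on the edges: give the first edge a colour unmarked at both ends and mark
  these ends. As \<open>vs\<close> is distinct, the new edge meets no other listed vertex, so the
  new columns are again correct.\<close>

lemma colourable_sound:
  assumes "realizable F k vs ms" "colourable es ms"
    and "\<forall>(i, j)\<in>set es. i < length vs \<and> j < length vs" and "distinct vs"
  shows "\<exists>c. proper_edge_coloring (F \<union> (\<lambda>(i, j). {vs ! i, vs ! j}) ` set es) k c"
  using assms
proof (induction es arbitrary: F ms)
  case Nil
  then show ?case unfolding realizable_def by auto
next
  case (Cons ij es)
  obtain i j where ij: "ij = (i, j)" by (cases ij)
  have lt: "i < length vs" "j < length vs" using Cons.prems(3) ij by auto
  obtain ms' where ms': "ms' \<in> set (place i j ms)" "colourable es ms'"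
    using Cons.prems(2) ij by (auto simp: some_list_iff)
  obtain p where p: "p < length ms" "\<not> ms ! p ! i" "\<not> ms ! p ! j"
    "ms' = ms[p := (ms ! p)[i := True, j := True]]"
    using place_nth[OF ms'(1)] by blast
  obtain c xs where c: "proper_edge_coloring F k c" "distinct xs" "set xs \<subseteq> {..<k}"
    "list_all2 (covers F c vs) xs ms"
    using Cons.prems(1) unfolding realizable_def by blast
  have len: "length xs = length ms" and cov: "\<And>q. q < length ms \<Longrightarrow> covers F c vs (xs ! q) (ms ! q)"
    using c(4) by (auto simp: list_all2_conv_all_nth)
  define e where "e = {vs ! i, vs ! j}"
  let ?F = "insert e F" and ?c = "c(e := xs ! p)"
  have "xs ! p < k" using c(3) len p(1) nth_mem[of p xs] by (metis lessThan_iff subsetD)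
  moreover have "\<not> sees F c (vs ! i) (xs ! p)" "\<not> sees F c (vs ! j) (xs ! p)"
    using cov[OF p(1)] p(2,3) lt unfolding covers_def by blast+
  ultimately have newc: "proper_edge_coloring ?F k ?c"
    using proper_insert[OF c(1)] unfolding e_def by metis
  have sees_new: "sees ?F ?c v x \<Longrightarrow> sees F c v x \<or> (v \<in> e \<and> x = xs ! p)" for v x
    unfolding sees_def by (auto split: if_splits)
  have "covers ?F ?c vs (xs ! q) (ms' ! q)" if q: "q < length ms" for q
    unfolding covers_def
  proof (intro conjI allI impI)
    show "length (ms' ! q) = length vs"
      using cov[OF q] p q unfolding covers_def by (auto simp: nth_list_update)
    fix l assume l: "l < length vs" "sees ?F ?c (vs ! l) (xs ! q)"
    have lm: "length (ms ! p) = length vs" using cov[OF p(1)] unfolding covers_def by simp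
    from sees_new[OF l(2)] show "ms' ! q ! l"
    proof
      assume "sees F c (vs ! l) (xs ! q)"
      then have "ms ! q ! l" using cov[OF q] l(1) unfolding covers_def by blast
      then show ?thesis using p q l(1) lm
        by (cases "p = q") (auto simp: nth_two_updates)
    next
      assume a: "vs ! l \<in> e \<and> xs ! q = xs ! p"
      then have "q = p" using c(2) len q p(1) nth_eq_iff_index_eq by metis
      moreover have "l = i \<or> l = j"
        using a l(1) lt nth_eq_iff_index_eq[OF Cons.prems(4)] unfolding e_def by auto
      ultimately show ?thesis using p l(1) lm by (auto simp: nth_two_updates)
    qed
  qed
  then have "list_all2 (covers ?F ?c vs) xs ms'"
    using len p(4) by (simp add: list_all2_conv_all_nth)
  then have "realizable ?F k vs ms'" unfolding realizable_def using newc c(2,3) by blast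
  from Cons.IH[OF this ms'(2)] Cons.prems(3,4) show ?case
    unfolding ij e_def by auto
qed

lemma length_flip [simp]: "length (flip a b) = min (length a) (length b)"
  unfolding flip_def by simp

lemma nth_flip [simp]: "i < length a \<Longrightarrow> i < length b \<Longrightarrow> flip a b ! i \<longleftrightarrow> a ! i \<noteq> b ! i"
  unfolding flip_def by simp

definition unit :: "nat \<Rightarrow> nat \<Rightarrow> bool list" where
  "unit n i = (replicate n False)[i := True]"

lemma length_unit [simp]: "length (unit n i) = n"
  unfolding unit_def by simp

lemma nth_unit [simp]: "j < n \<Longrightarrow> unit n i ! j \<longleftrightarrow> j = i"
  unfolding unit_def by (cases "i = j") simp_all

lemma units_eq: "units d = map (unit (length d)) (filter (\<lambda>i. d ! i) [0..<length d])"
proof (induction d)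
  case Nil
  then show ?case by simp
next
  case (Cons b d)
  have "[0..<length (b # d)] = 0 # map Suc [0..<length d]"
    by (simp add: map_Suc_upt upt_conv_Cons del: upt_Suc)
  moreover have "unit (Suc n) (Suc i) = False # unit n i" "unit (Suc n) 0 = True # replicate n False" for n i
    unfolding unit_def by simp_all
  ultimately show ?case using Cons by (simp add: filter_map o_def)
qed

text \<open>\<open>cl\<close> stands for the masks that may be swapped and \<open>Q\<close> for the
  true pairing of chain ends. One branch of each query agrees with \<open>Q\<close>, and following
  these leads to a win or to \<open>k\<close>. By \<open>inner\<close>, the partner of a remaining
  end is still in the list.\<close>

lemma ask_sound:
  fixes cl :: "bool list \<Rightarrow> bool"
  assumes "ask t k us L" "\<forall>u\<in>set us. cl u"
    and "distinct L" "set L \<subseteq> A"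
    and flip: "\<And>a b. cl a \<Longrightarrow> cl b \<Longrightarrow> cl (flip a b)"
    and alone: "\<And>i. i \<in> A \<Longrightarrow> (\<forall>j\<in>A. \<not> Q i j) \<Longrightarrow> cl i"
    and pair: "\<And>i j. i \<in> A \<Longrightarrow> j \<in> A \<Longrightarrow> Q i j \<Longrightarrow> cl (flip i j)"
    and sym: "\<And>i j. Q i j \<Longrightarrow> Q j i" and irrefl: "\<And>i. \<not> Q i i"
    and unique: "\<And>i j l. Q i j \<Longrightarrow> Q i l \<Longrightarrow> j = l"
    and inner: "\<And>i j. i \<in> set L \<Longrightarrow> j \<in> A \<Longrightarrow> Q i j \<Longrightarrow> j \<in> set L"
  shows "(\<exists>m. cl m \<and> t m) \<or> (\<exists>us'. (\<forall>u\<in>set us'. cl u) \<and> k us')"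
  using assms(1-4) inner
proof (induction "length L" arbitrary: L us rule: less_induct)
  case less
  show ?case
  proof (cases L)
    case Nil
    then show ?thesis using less.prems by auto
  next
    case (Cons i L')
    have step: ?thesis
      if g: "cl g" and M: "distinct M" "set M \<subseteq> A" "length M < length L"
        "\<And>a j. a \<in> set M \<Longrightarrow> j \<in> A \<Longrightarrow> Q a j \<Longrightarrow> j \<in> set M"
        and a: "if some_list (\<lambda>u. t (flip g u)) us then True else ask t k (us @ map (flip g) us) M"
      for g M
    proof (cases "some_list (\<lambda>u. t (flip g u)) us")
      case True
      then show ?thesis using g less.prems(2) flip by (auto simp: some_list_iff)
    next
      case False
      then have "ask t k (us @ map (flip g) us) M" using a by simp
      moreover have "\<forall>u\<in>set (us @ map (flip g) us). cl u"
        using g less.prems(2) flip by auto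
      ultimately show ?thesis using less.hyps M by blast
    qed
    have all: "list_all (\<lambda>(g, M). if some_list (\<lambda>u. t (flip g u)) us then True
        else ask t k (us @ map (flip g) us) M) ((i, L') # map (\<lambda>j. (flip i j, remove1 j L')) L')"
      using less.prems(1) unfolding Cons ask.simps .
    have iA: "i \<in> A" "i \<notin> set L'" "distinct L'" using less.prems Cons by auto
    show ?thesis
    proof (cases "\<exists>j\<in>A. Q i j")
      case False
      show ?thesis
      proof (rule step)
        show "cl i" using alone iA False by blast
        show "if some_list (\<lambda>u. t (flip i u)) us then True else ask t k (us @ map (flip i) us) L'"
          using all by simp
        fix a j assume "a \<in> set L'" "j \<in> A" "Q a j"
        then show "j \<in> set L'"
          using less.prems(5)[of a j] Cons False sym less.prems(4) by (metis list.set_intros(2) set_ConsD subsetD)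
      qed (use less.prems Cons in auto)
    next
      case True
      then obtain j where j: "j \<in> A" "Q i j" by blast
      have jL: "j \<in> set L'" using less.prems(5)[of i j] j Cons irrefl by auto
      show ?thesis
      proof (rule step)
        show "cl (flip i j)" using pair iA j by blast
        show "if some_list (\<lambda>u. t (flip (flip i j) u)) us then True
            else ask t k (us @ map (flip (flip i j)) us) (remove1 j L')"
          using all jL by (auto simp: list_all_iff simp del: ask.simps)
        fix a b assume a: "a \<in> set (remove1 j L')" "b \<in> A" "Q a b"
        then have "a \<in> set L'" "a \<noteq> j" using iA by auto
        then have "b \<in> set L" using less.prems(5)[of a b] a Cons by auto
        moreover have "b \<noteq> i" using a(3) j(2) sym unique \<open>a \<noteq> j\<close> by metis
        moreover have "b \<noteq> j" using a(3) j(2) sym unique \<open>a \<in> set L'\<close> iA(2) by metis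
        ultimately show "b \<in> set (remove1 j L')" using Cons iA by auto
      qed (use less.prems Cons iA jL in \<open>auto simp: length_remove1\<close>)
    qed
  qed
qed

text \<open>The masks that may be swapped: no chain with both ends in the configuration is split.
  Entries where the columns differ but neither colour occurs are unconstrained, because either mark
  is correct there.\<close>

definition closed_mask :: "'a set set \<Rightarrow> 'a list \<Rightarrow> bool list \<Rightarrow> bool list \<Rightarrow> bool" where
  "closed_mask U vs d m \<longleftrightarrow> length m = length vs \<and> (\<forall>i<length vs. m ! i \<longrightarrow> d ! i) \<and>
     (\<forall>i<length vs. \<forall>j<length vs. d ! i \<and> d ! j \<and> endpt U (vs ! i) \<and> endpt U (vs ! j) \<and>
        (vs ! i, vs ! j) \<in> linked U \<longrightarrow> (m ! i \<longleftrightarrow> m ! j))"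

lemma kempe_covers:
  assumes g: "graph F" and c: "proper_edge_coloring F k c" and xy: "x < k" "y < k" "x \<noteq> y"
    and cov: "covers F c vs x mx" "covers F c vs y my"
    and m: "closed_mask (bicol F c x y) vs (flip mx my) m"
  obtains c' where "proper_edge_coloring F k c'"
    "covers F c' vs x (flip m mx)" "covers F c' vs y (flip m my)"
    "\<And>v z. z \<noteq> x \<Longrightarrow> z \<noteq> y \<Longrightarrow> sees F c' v z \<longleftrightarrow> sees F c v z"
    "\<And>z w. z \<notin> {x, y} \<Longrightarrow> w \<notin> {x, y} \<Longrightarrow> bicol F c' z w = bicol F c z w"
proof -
  let ?U = "bicol F c x y"
  \<comment> \<open>The chains starting at genuine ends selected by \<open>m\<close>. Where the
    columns agree, an exchange cannot violate them, so \<open>Z\<close> need only match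
    \<open>m\<close> where they differ.\<close>
  define Z where "Z = linked ?U `` {vs ! i | i. i < length vs \<and> m ! i \<and> endpt ?U (vs ! i)}"
  have sat: "saturated ?U Z" unfolding Z_def by (rule saturated_linked[OF graph_bicol[OF g]])
  have fin: "finite F" using g unfolding graph_def by blast
  note ep = endpt_bicol[OF c fin xy(3)]
  have len: "length m = length vs" "length mx = length vs" "length my = length vs"
    using m cov unfolding closed_mask_def covers_def by blast+
  have dd: "flip mx my ! j \<longleftrightarrow> mx ! j \<noteq> my ! j" if "j < length vs" for j
    using that len by simp
  have sx: "sees F c (vs ! j) x \<Longrightarrow> mx ! j" and sy: "sees F c (vs ! j) y \<Longrightarrow> my ! j"
    if "j < length vs" for j
    using that cov unfolding covers_def by blast+
  have md: "mx ! j \<noteq> my ! j" if "j < length vs" "m ! j" for j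
    using m that dd unfolding closed_mask_def by blast
  have inZ: "m ! j" if j: "j < length vs" "vs ! j \<in> Z" "mx ! j \<noteq> my ! j" "endpt ?U (vs ! j)" for j
  proof -
    obtain i where i: "i < length vs" "m ! i" "endpt ?U (vs ! i)" "(vs ! i, vs ! j) \<in> linked ?U"
      using j(2) unfolding Z_def by blast
    moreover have "flip mx my ! i" "flip mx my ! j" using dd md i j by blast+
    ultimately show ?thesis using m j unfolding closed_mask_def by blast
  qed
  have notZ: "\<not> endpt ?U (vs ! j)" if "j < length vs" "vs ! j \<notin> Z" "m ! j" for j
  proof
    assume "endpt ?U (vs ! j)"
    then have "vs ! j \<in> {vs ! i | i. i < length vs \<and> m ! i \<and> endpt ?U (vs ! i)}" using that by blast
    then have "vs ! j \<in> Z" unfolding Z_def using linked_refl[of "vs ! j" ?U] by (rule ImageI[rotated])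
    then show False using that by blast
  qed
  have "covers F (kempe Z x y c) vs x (flip m mx) \<and> covers F (kempe Z x y c) vs y (flip m my)"
    unfolding covers_def
  proof (intro conjI allI impI)
    fix j assume j: "j < length vs"
    have "(sees F c (vs ! j) (if vs ! j \<in> Z then y else x) \<longrightarrow> (m ! j \<noteq> mx ! j)) \<and>
      (sees F c (vs ! j) (if vs ! j \<in> Z then x else y) \<longrightarrow> (m ! j \<noteq> my ! j))"
    proof (cases "vs ! j \<in> Z")
      case True
      then show ?thesis
        using sx[OF j] sy[OF j] md[OF j] inZ[OF j] unfolding ep by (simp only: if_True) blast
    next
      case False
      then show ?thesis
        using sx[OF j] sy[OF j] md[OF j] notZ[OF j] unfolding ep by (simp only: if_False) blast
    qed
    then show "sees F (kempe Z x y c) (vs ! j) x \<Longrightarrow> flip m mx ! j"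
      and "sees F (kempe Z x y c) (vs ! j) y \<Longrightarrow> flip m my ! j"
      using j len xy(3) unfolding kempe_sees[OF sat] by (auto split: if_splits)
  qed (use len in auto)
  moreover have "proper_edge_coloring F k (kempe Z x y c)" using kempe_proper[OF c xy(1,2) sat] .
  moreover have "sees F (kempe Z x y c) v z \<longleftrightarrow> sees F c v z" if "z \<noteq> x" "z \<noteq> y" for v z
    unfolding kempe_sees[OF sat] using that by simp
  moreover have "bicol F (kempe Z x y c) z w = bicol F c z w" if "z \<notin> {x, y}" "w \<notin> {x, y}" for z w
    using kempe_bicol that by (metis insertCI)
  ultimately show thesis using that by blast
qed

section \<open>Queries put to an actual colouring\<close>

lemma distinct_units: "distinct (units d)"
proof -
  have "inj_on (unit n) {..<n}" for n
  proof (rule inj_onI)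
    fix i j assume "i \<in> {..<n}" "j \<in> {..<n}" "unit n i = unit n j"
    then show "i = j" using nth_unit[of i n i] nth_unit[of i n j] by auto
  qed
  then show ?thesis unfolding units_eq
    by (intro distinct_map_filter) (auto simp: distinct_map atLeast0LessThan)
qed

text \<open>An instance of \<open>ask_sound\<close> in which two ends are paired if they lie on one
  chain. This is a partial matching because a chain has at most two ends.\<close>

lemma ask_kempe:
  assumes g: "graph F" and c: "proper_edge_coloring F k c" and xy: "x \<noteq> y"
    and vs: "distinct vs" "length d = length vs"
    and ask: "ask t l [replicate (length vs) False] (units d)"
  shows "(\<exists>m. closed_mask (bicol F c x y) vs d m \<and> t m) \<or>
    (\<exists>us. (\<forall>u\<in>set us. closed_mask (bicol F c x y) vs d u) \<and> l us)"
proof -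
  let ?U = "bicol F c x y" and ?n = "length vs"
  have fin: "finite F" using g unfolding graph_def by blast
  note ep = endpt_bicol[OF c fin xy]
  define R where "R i j \<longleftrightarrow> i < ?n \<and> j < ?n \<and> i \<noteq> j \<and> d ! i \<and> d ! j \<and>
    endpt ?U (vs ! i) \<and> endpt ?U (vs ! j) \<and> (vs ! i, vs ! j) \<in> linked ?U" for i j
  define Q where "Q a b \<longleftrightarrow> (\<exists>i j. a = unit ?n i \<and> b = unit ?n j \<and> R i j)" for a b
  have uinj: "i = j" if "unit ?n i = unit ?n j" "i < ?n" for i j
    using that nth_unit[of i ?n i] nth_unit[of i ?n j] by auto
  have Runique: "j = l" if "R i j" "R i l" for i j l
  proof (rule ccontr)
    assume "j \<noteq> l"
    then show False
      using that vs(1) two_ends_bicol[OF g c xy, of "vs ! i" "vs ! j" "vs ! l"]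
      unfolding R_def ep by (auto simp: nth_eq_iff_index_eq)
  qed
  have Rsym: "R i j \<Longrightarrow> R j i" for i j unfolding R_def using linked_sym by metis
  have units: "a \<in> set (units d) \<longleftrightarrow> (\<exists>i<?n. d ! i \<and> a = unit ?n i)" for a
    unfolding units_eq using vs(2) by auto
  have closedI: "closed_mask ?U vs d m" if "length m = ?n" "\<And>i. i < ?n \<Longrightarrow> m ! i \<Longrightarrow> d ! i"
    "\<And>i j. R i j \<Longrightarrow> m ! i \<Longrightarrow> m ! j" for m
    using that Rsym unfolding closed_mask_def R_def by blast
  show ?thesis
  proof (rule ask_sound[OF ask, where A = "set (units d)" and Q = Q])
    show "\<forall>u\<in>set [replicate ?n False]. closed_mask ?U vs d u"
      by (auto simp: closed_mask_def)
    show "distinct (units d)" by (rule distinct_units)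
    show "closed_mask ?U vs d (flip a b)" if "closed_mask ?U vs d a" "closed_mask ?U vs d b" for a b
    proof (rule closedI)
      have ab: "length a = ?n" "length b = ?n" using that unfolding closed_mask_def by blast+
      then show "length (flip a b) = ?n" by simp
      show "flip a b ! i \<Longrightarrow> d ! i" if i: "i < ?n" for i
      proof -
        have "a ! i \<longrightarrow> d ! i" "b ! i \<longrightarrow> d ! i"
          using \<open>closed_mask ?U vs d a\<close> \<open>closed_mask ?U vs d b\<close> i unfolding closed_mask_def by blast+
        then show "flip a b ! i \<Longrightarrow> d ! i" using i ab by auto
      qed
      show "flip a b ! j" if "R i j" "flip a b ! i" for i j
      proof -
        have "a ! i = a ! j" "b ! i = b ! j" "i < ?n" "j < ?n"
          using \<open>closed_mask ?U vs d a\<close> \<open>closed_mask ?U vs d b\<close> \<open>R i j\<close>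
          unfolding closed_mask_def R_def by blast+
        then show ?thesis using that(2) ab by simp
      qed
    qed
    show "Q a b \<Longrightarrow> Q b a" for a b unfolding Q_def using Rsym by blast
    show "\<not> Q a a" for a unfolding Q_def R_def using uinj by blast
    show "b = b'" if qab: "Q a b" "Q a b'" for a b b'
    proof -
      obtain i j where ij: "a = unit ?n i" "b = unit ?n j" "R i j"
        using qab(1) unfolding Q_def by blast
      obtain i' j' where ij': "a = unit ?n i'" "b' = unit ?n j'" "R i' j'"
        using qab(2) unfolding Q_def by blast
      have "i = i'" using uinj[of i i'] ij ij' unfolding R_def by simp
      then show ?thesis using Runique ij ij' by blast
    qed
    show "closed_mask ?U vs d a" if a: "a \<in> set (units d)" "\<forall>b\<in>set (units d). \<not> Q a b" for a
    proof -
      obtain i where i: "i < ?n" "d ! i" "a = unit ?n i" using a(1) units by blast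
      have "\<not> R i j" for j
        using a(2) i units unfolding Q_def R_def by blast
      then show ?thesis using i by (intro closedI) (auto simp: R_def)
    qed
    show "closed_mask ?U vs d (flip a b)" if ab: "a \<in> set (units d)" "b \<in> set (units d)" "Q a b" for a b
    proof -
      obtain i j where ij: "a = unit ?n i" "b = unit ?n j" "R i j" using ab(3) unfolding Q_def by blast
      have lt: "i < ?n" "j < ?n" "i \<noteq> j" "d ! i" "d ! j" using ij(3) unfolding R_def by auto
      show ?thesis
      proof (rule closedI)
        show "length (flip a b) = ?n" using ij by simp
        show "flip a b ! l \<Longrightarrow> d ! l" if "l < ?n" for l using that ij lt by auto
        fix l l' assume l: "R l l'" "flip a b ! l"
        then have "l < ?n" "l' < ?n" unfolding R_def by auto
        then have "l = i \<or> l = j" using l(2) ij by auto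
        then have "l' = j \<or> l' = i" "l' \<noteq> l" using Runique Rsym ij(3) l(1) unfolding R_def by blast+
        then show "flip a b ! l'" using \<open>l' < ?n\<close> \<open>l = i \<or> l = j\<close> ij lt by auto
      qed
    qed
  qed simp_all
qed

text \<open>A colouring that realizes the row fixes the true chains, so some winning swap is legal
  for it. The swapped colouring realizes a position that is colourable or in \<open>tab\<close>, and
  both are excluded.\<close>

lemma beats_sound:
  assumes "graph F" "distinct vs" "beats es tab p"
    and es: "\<forall>(i, j)\<in>set es. i < length vs \<and> j < length vs"
    and tab: "\<forall>ms\<in>set tab. \<not> realizable F k vs ms"
    and unc: "\<nexists>c. proper_edge_coloring (F \<union> (\<lambda>(i, j). {vs ! i, vs ! j}) ` set es) k c"
  shows "\<not> realizable F k vs (snd p)"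
proof
  assume real: "realizable F k vs (snd p)"
  have good: "\<not> realizable F k vs ms" if "good es tab ms" for ms
  proof (cases "colourable es ms")
    case True
    then show ?thesis using colourable_sound[OF _ True es assms(2)] unc by blast
  next
    case False
    then have "canon ms \<in> set tab" using that unfolding good_def by (simp add: some_list_iff)
    then show ?thesis using tab realizable_mset[OF _ mset_canon] by blast
  qed
  obtain c xs where c: "proper_edge_coloring F k c" "distinct xs" "set xs \<subseteq> {..<k}"
    "list_all2 (covers F c vs) xs (snd p)"
    using real unfolding realizable_def by blast
  have covers_cong: "list_all2 (covers F c' vs) xs' ms"
    if "list_all2 (covers F c vs) xs' ms" "\<And>v z. z \<in> set xs' \<Longrightarrow> sees F c' v z \<longleftrightarrow> sees F c v z" for c c' xs' ms
    using that unfolding covers_def list_all2_conv_all_nth by (metis nth_mem)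
  show False
    using assms(3)
  proof (cases rule: beats.elims(2))
    case (1 tab' mx my ms)
    then obtain x y xs' where xs: "xs = x # y # xs'" "covers F c vs x mx" "covers F c vs y my"
      "list_all2 (covers F c vs) xs' ms"
      using c(4) by (auto simp: list_all2_Cons2)
    have xy: "x < k" "y < k" "x \<noteq> y" using c(2,3) xs(1) by auto
    have len: "length mx = length vs" "length my = length vs" using xs unfolding covers_def by auto
    have "ask (\<lambda>m. good es tab (flip m mx # flip m my # ms)) (\<lambda>_. False)
       [replicate (length vs) False] (units (flip mx my))"
      using 1 len by simp
    from ask_kempe[OF assms(1) c(1) xy(3) assms(2) _ this] len
    obtain m where m: "closed_mask (bicol F c x y) vs (flip mx my) m"
      "good es tab (flip m mx # flip m my # ms)" by auto
    obtain c' where c': "proper_edge_coloring F k c'"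
      "covers F c' vs x (flip m mx)" "covers F c' vs y (flip m my)"
      "\<And>v z. z \<noteq> x \<Longrightarrow> z \<noteq> y \<Longrightarrow> sees F c' v z \<longleftrightarrow> sees F c v z"
      using kempe_covers[OF assms(1) c(1) xy xs(2,3) m(1)] by metis
    have "list_all2 (covers F c' vs) xs' ms"
    proof (rule covers_cong[OF xs(4)])
      fix v z assume "z \<in> set xs'"
      then have "z \<noteq> x" "z \<noteq> y" using c(2) xs(1) by auto
      then show "sees F c' v z \<longleftrightarrow> sees F c v z" by (rule c'(4))
    qed
    then have "realizable F k vs (flip m mx # flip m my # ms)"
      using c' c(2,3) xs(1) unfolding realizable_def by (intro exI[of _ c'] exI[of _ xs]) auto
    then show False using good m(2) by blast
  next
    case (2 tab' mx my mz mw ms)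
    then obtain x y z w xs' where xs: "xs = x # y # z # w # xs'" "covers F c vs x mx" "covers F c vs y my"
      "covers F c vs z mz" "covers F c vs w mw" "list_all2 (covers F c vs) xs' ms"
      using c(4) by (auto simp: list_all2_Cons2)
    have xy: "x < k" "y < k" "x \<noteq> y" and zw: "z < k" "w < k" "z \<noteq> w"
      and dis: "z \<notin> {x, y}" "w \<notin> {x, y}" using c(2,3) xs(1) by auto
    have len: "length mx = length vs" "length my = length vs" "length mz = length vs" "length mw = length vs"
      using xs unfolding covers_def by auto
    \<comment> \<open>The first swap leaves the chains of \<open>z\<close> and \<open>w\<close>
      unchanged, so the answers to the second query, obtained for \<open>c\<close>, stay valid after
      it.\<close>
    have flipped: "\<exists>c'. proper_edge_coloring F k c' \<and> bicol F c' z w = bicol F c z w \<and>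
        list_all2 (covers F c' vs) xs (flip m mx # flip m my # mz # mw # ms)"
      if cm: "closed_mask (bicol F c x y) vs (flip mx my) m" for m
    proof -
      obtain c' where c': "proper_edge_coloring F k c'"
        "covers F c' vs x (flip m mx)" "covers F c' vs y (flip m my)"
        "\<And>v z. z \<noteq> x \<Longrightarrow> z \<noteq> y \<Longrightarrow> sees F c' v z \<longleftrightarrow> sees F c v z"
        "bicol F c' z w = bicol F c z w"
        using kempe_covers[OF assms(1) c(1) xy xs(2,3) cm] dis by metis
      have "list_all2 (covers F c vs) (z # w # xs') (mz # mw # ms)" using xs by simp
      then have "list_all2 (covers F c' vs) (z # w # xs') (mz # mw # ms)"
      proof (rule covers_cong)
        fix v a assume "a \<in> set (z # w # xs')"
        then have "a \<noteq> x" "a \<noteq> y" using c(2) xs(1) by auto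
        then show "sees F c' v a \<longleftrightarrow> sees F c v a" by (rule c'(4))
      qed
      then show ?thesis using c' xs(1) by auto
    qed
    let ?l = "\<lambda>us. ask (\<lambda>m'. some_list (\<lambda>m. good es tab
           (flip m mx # flip m my # flip m' mz # flip m' mw # ms)) us)
         (\<lambda>_. False) [replicate (length vs) False] (units (flip mz mw))"
    have "ask (\<lambda>m. good es tab (flip m mx # flip m my # mz # mw # ms)) ?l
       [replicate (length vs) False] (units (flip mx my))"
      using 2 len by simp
    from ask_kempe[OF assms(1) c(1) xy(3) assms(2) _ this] len
    consider m where "closed_mask (bicol F c x y) vs (flip mx my) m"
        "good es tab (flip m mx # flip m my # mz # mw # ms)"
      | us where "\<forall>u\<in>set us. closed_mask (bicol F c x y) vs (flip mx my) u" "?l us"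
      by auto
    then show False
    proof cases
      case 1
      then have "realizable F k vs (flip m mx # flip m my # mz # mw # ms)"
        using flipped c(2,3) unfolding realizable_def by blast
      then show False using good 1 by blast
    next
      case us: 2
      from ask_kempe[OF assms(1) c(1) zw(3) assms(2) _ us(2)] len
      obtain m m' where m: "closed_mask (bicol F c x y) vs (flip mx my) m"
        "closed_mask (bicol F c z w) vs (flip mz mw) m'"
        "good es tab (flip m mx # flip m my # flip m' mz # flip m' mw # ms)"
        using us(1) by (auto simp: some_list_iff)
      obtain c' where c': "proper_edge_coloring F k c'" "bicol F c' z w = bicol F c z w"
        "list_all2 (covers F c' vs) xs (flip m mx # flip m my # mz # mw # ms)"
        using flipped[OF m(1)] by blast
      have cov: "covers F c' vs z mz" "covers F c' vs w mw"
        "list_all2 (covers F c' vs) (x # y # xs') (flip m mx # flip m my # ms)"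
        using c'(3) xs(1) by auto
      obtain c'' where c'': "proper_edge_coloring F k c''"
        "covers F c'' vs z (flip m' mz)" "covers F c'' vs w (flip m' mw)"
        "\<And>v a. a \<noteq> z \<Longrightarrow> a \<noteq> w \<Longrightarrow> sees F c'' v a \<longleftrightarrow> sees F c' v a"
        using kempe_covers[OF assms(1) c'(1) zw cov(1,2), of m'] m(2) c'(2) by metis
      have "list_all2 (covers F c'' vs) (x # y # xs') (flip m mx # flip m my # ms)"
      proof (rule covers_cong[OF cov(3)])
        fix v a assume "a \<in> set (x # y # xs')"
        then have "a \<noteq> z" "a \<noteq> w" using c(2) xs(1) by auto
        then show "sees F c'' v a \<longleftrightarrow> sees F c' v a" by (rule c''(4))
      qed
      then have "list_all2 (covers F c'' vs) xs (flip m mx # flip m my # flip m' mz # flip m' mw # ms)"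
        using c'' xs(1) by auto
      then have "realizable F k vs (flip m mx # flip m my # flip m' mz # flip m' mw # ms)"
        using c'' c(2,3) unfolding realizable_def by blast
      then show False using good m(3) by blast
    qed
  qed
qed

lemma check_sound:
  assumes "graph F" "distinct vs" "check es tab ps"
    and "\<forall>(i, j)\<in>set es. i < length vs \<and> j < length vs"
    and "\<forall>ms\<in>set tab. \<not> realizable F k vs ms"
    and "\<nexists>c. proper_edge_coloring (F \<union> (\<lambda>(i, j). {vs ! i, vs ! j}) ` set es) k c"
    and "p \<in> set ps" "mset ms = mset (snd p)"
  shows "\<not> realizable F k vs ms"
  using assms(3,5,7)
proof (induction ps arbitrary: tab)
  case Nil
  then show ?case by simp
next
  case (Cons q ps)
  have b: "beats es tab q" "check es (canon (snd q) # tab) ps"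
    using Cons.prems(1) by (auto split: if_splits)
  have q: "\<not> realizable F k vs (snd q)"
    using beats_sound[OF assms(1,2) b(1) assms(4) Cons.prems(2) assms(6)] .
  have "\<not> realizable F k vs (canon (snd q))"
    using q realizable_mset[of F k vs "canon (snd q)" "snd q"] mset_canon by metis
  then show ?case
    using Cons.IH[OF b(2)] Cons.prems(2,3) q assms(8) realizable_mset[of F k vs ms "snd q"] by auto
qed

section \<open>Critical graphs\<close>

lemma covers_iff: "covers F c vs x m \<longleftrightarrow> list_all2 (\<lambda>v b. sees F c v x \<longrightarrow> b) vs m"
  unfolding covers_def list_all2_conv_all_nth by auto

lemma sees_mono: "sees F c v x \<Longrightarrow> F \<subseteq> F' \<Longrightarrow> sees F' c v x"
  unfolding sees_def by blast

lemma not_sees_removed: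
  assumes "proper_edge_coloring F' k c" "e \<in> F'" "v \<in> e" "F \<subseteq> F' - {e}"
  shows "\<not> sees F c v (c e)"
proof
  assume "sees F c v (c e)"
  then obtain f where f: "f \<in> F" "v \<in> f" "c f = c e" unfolding sees_def by blast
  then have "f \<in> F'" using assms(4) by blast
  then have "e = f" using proper_unique[OF assms(1,2) _ assms(3)] f by simp
  then show False using f assms(4) by blast
qed

section \<open>Neighbours along edges of prescribed colours\<close>

definition nbrs :: "'a set set \<Rightarrow> ('a set \<Rightarrow> nat) \<Rightarrow> nat set \<Rightarrow> 'a \<Rightarrow> 'a set" where
  "nbrs F c S v = {u. {v, u} \<in> F \<and> c {v, u} \<in> S}"

lemma nbr_inj:
  assumes "proper_edge_coloring F k c"
  shows "inj_on (\<lambda>u. c {v, u}) {u. {v, u} \<in> F}"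
proof (rule inj_onI)
  fix u w assume "u \<in> {u. {v, u} \<in> F}" "w \<in> {u. {v, u} \<in> F}" "c {v, u} = c {v, w}"
  then have "{v, u} = {v, w}" using proper_unique[OF assms, of "{v, u}" "{v, w}" v] by simp
  then show "u = w" by (auto simp: doubleton_eq_iff)
qed

lemma card_nbrs:
  assumes "graph F" "proper_edge_coloring F k c"
  shows "card (nbrs F c S v) = card {x \<in> S. sees F c v x}"
proof -
  have "(\<lambda>u. c {v, u}) ` nbrs F c S v = {x \<in> S. sees F c v x}"
  proof
    show "{x \<in> S. sees F c v x} \<subseteq> (\<lambda>u. c {v, u}) ` nbrs F c S v"
    proof
      fix x assume "x \<in> {x \<in> S. sees F c v x}"
      then obtain e where e: "e \<in> F" "v \<in> e" "c e = x" "x \<in> S" unfolding sees_def by blast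
      obtain u where "e = {v, u}" using graph_edge[OF assms(1) e(1,2)] by blast
      then show "x \<in> (\<lambda>u. c {v, u}) ` nbrs F c S v" using e unfolding nbrs_def by blast
    qed
  qed (auto simp: nbrs_def sees_def)
  moreover have "inj_on (\<lambda>u. c {v, u}) (nbrs F c S v)"
    by (rule inj_on_subset[OF nbr_inj[OF assms(2)]]) (auto simp: nbrs_def)
  ultimately show ?thesis using card_image[of "\<lambda>u. c {v, u}" "nbrs F c S v"] by simp
qed

text \<open>Two colour sets of size \<open>card I\<close> inside \<open>S\<close>, namely the colours between \<open>I\<close> and each of
  the two vertices, must meet.\<close>

lemma common_colour:
  assumes "proper_edge_coloring F k c" "finite S" "card S < 2 * card I"
    and "I \<subseteq> nbrs F c S s \<inter> nbrs F c S v"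
  obtains u w where "u \<in> I" "w \<in> I" "c {s, w} = c {v, u}"
proof -
  have card: "card ((\<lambda>u. c {x, u}) ` I) = card I" if "x = s \<or> x = v" for x
    by (rule card_image, rule inj_on_subset[OF nbr_inj[OF assms(1)]])
      (use that assms(4) in \<open>auto simp: nbrs_def\<close>)
  have sub: "(\<lambda>u. c {x, u}) ` I \<subseteq> S" if "x = s \<or> x = v" for x
    using that assms(4) by (auto simp: nbrs_def)
  have "(\<lambda>u. c {s, u}) ` I \<inter> (\<lambda>u. c {v, u}) ` I \<noteq> {}"
  proof
    assume "(\<lambda>u. c {s, u}) ` I \<inter> (\<lambda>u. c {v, u}) ` I = {}"
    then have "card ((\<lambda>u. c {s, u}) ` I \<union> (\<lambda>u. c {v, u}) ` I) = 2 * card I"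
      using card sub finite_subset[OF sub assms(2)] by (subst card_Un_disjoint) simp_all
    moreover have "card ((\<lambda>u. c {s, u}) ` I \<union> (\<lambda>u. c {v, u}) ` I) \<le> card S"
      using sub assms(2) by (intro card_mono) auto
    ultimately show False using assms(3) by simp
  qed
  then show thesis using that by blast
qed

text \<open>\<open>k\<close> will be the maximum degree. Criticality enters as colourability with
  \<open>k\<close> colours after the deletion of any edge, but not before.\<close>

locale critical_graph =
  fixes V :: "'a set" and E :: "'a set set" and k :: nat
  assumes finite_V: "finite V" and edge: "\<And>e. e \<in> E \<Longrightarrow> e \<subseteq> V \<and> card e = 2"
    and uncolourable: "\<And>c. \<not> proper_edge_coloring E k c"
    and deletion: "\<And>e. e \<in> E \<Longrightarrow> \<exists>c. proper_edge_coloring (E - {e}) k c"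
    and degree_le: "\<And>v. v \<in> V \<Longrightarrow> vertex_degree E v \<le> k"
begin

lemma graph: "F \<subseteq> E \<Longrightarrow> graph F"
  unfolding graph_def using edge finite_V
  by (meson Pow_iff finite_Pow_iff finite_subset subset_eq)

lemma finite_edges: "F \<subseteq> E \<Longrightarrow> finite F"
  using graph unfolding graph_def by blast

definition miss :: "'a set set \<Rightarrow> ('a set \<Rightarrow> nat) \<Rightarrow> 'a \<Rightarrow> nat set" where
  "miss F c v = {x. x < k \<and> \<not> sees F c v x}"

lemma finite_miss [simp]: "finite (miss F c v)"
  unfolding miss_def by simp

lemma card_miss:
  assumes "F \<subseteq> E" "proper_edge_coloring F k c"
  shows "card (miss F c v) + vertex_degree F v = k"
proof -
  have "vertex_degree F v = card (c ` {e \<in> F. v \<in> e})"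
    unfolding vertex_degree_def using proper_unique[OF assms(2)]
    by (intro card_image[symmetric] inj_onI) blast
  also have "c ` {e \<in> F. v \<in> e} = {x. x < k \<and> sees F c v x}"
    using assms(2) unfolding sees_def proper_edge_coloring_def by blast
  finally have "card (miss F c v) + vertex_degree F v =
      card (miss F c v \<union> {x. x < k \<and> sees F c v x})"
    by (subst card_Un_disjoint) (auto simp: miss_def)
  also have "miss F c v \<union> {x. x < k \<and> sees F c v x} = {..<k}" unfolding miss_def by auto
  finally show ?thesis by simp
qed

lemma vertex_degree_delete:
  assumes "e \<in> E" "v \<in> e"
  shows "Suc (vertex_degree (E - {e}) v) = vertex_degree E v"
proof -
  have "{f \<in> E. v \<in> f} = insert e {f \<in> E - {e}. v \<in> f}" using assms by auto
  then show ?thesis unfolding vertex_degree_def using finite_edges[of E]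
    by (simp add: card_insert_disjoint)
qed

lemma vertex_degree_delete':
  assumes "v \<notin> e"
  shows "vertex_degree (E - {e}) v = vertex_degree E v"
proof -
  have "{f \<in> E - {e}. v \<in> f} = {f \<in> E. v \<in> f}" using assms by auto
  then show ?thesis unfolding vertex_degree_def by simp
qed

lemma sees_either:
  assumes "{x, y} \<in> E" "proper_edge_coloring (E - {{x, y}}) k c" "z < k"
  shows "sees (E - {{x, y}}) c x z \<or> sees (E - {{x, y}}) c y z"
proof (rule ccontr)
  assume "\<not> ?thesis"
  then have "proper_edge_coloring (insert {x, y} (E - {{x, y}})) k (c({x, y} := z))"
    using proper_insert[OF assms(2,3)] by blast
  moreover have "insert {x, y} (E - {{x, y}}) = E" using assms(1) by blast
  ultimately show False using uncolourable by metis
qed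

text \<open>The colours missing at the two ends are disjoint, since a common one could be given to
  the deleted edge. That edge adds one missing colour at each end, which accounts for the 2.\<close>

lemma degree_sum:
  assumes "{x, y} \<in> E"
  shows "k + 2 \<le> vertex_degree E x + vertex_degree E y"
proof -
  let ?F = "E - {{x, y}}"
  obtain c where c: "proper_edge_coloring ?F k c" using deletion[OF assms] by blast
  have "miss ?F c x \<inter> miss ?F c y = {}" using sees_either[OF assms c] unfolding miss_def by blast
  then have "card (miss ?F c x) + card (miss ?F c y) = card (miss ?F c x \<union> miss ?F c y)"
    by (simp add: card_Un_disjoint)
  also have "\<dots> \<le> card {..<k}" by (rule card_mono) (auto simp: miss_def)
  finally show ?thesis
    using card_miss[of ?F c x] card_miss[of ?F c y] c
      vertex_degree_delete[OF assms, of x] vertex_degree_delete[OF assms, of y] by simp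
qed

lemma no_realization:
  assumes "check es [] ps" "p \<in> set ps" "mset ms = mset (snd p)" "distinct vs"
    and "\<forall>(i, j)\<in>set es. i < length vs \<and> j < length vs"
    and L: "(\<lambda>(i, j). {vs ! i, vs ! j}) ` set es = L" "L \<subseteq> E"
    and c: "proper_edge_coloring (E - L) k c" "distinct xs" "set xs \<subseteq> {..<k}"
      "list_all2 (covers (E - L) c vs) xs ms"
  shows False
proof -
  have "(E - L) \<union> L = E" using L(2) by blast
  then have "\<not> realizable (E - L) k vs ms"
    using check_sound[OF graph[of "E - L"] assms(4,1,5) _ _ assms(2,3), of k] uncolourable
    unfolding L(1) by auto
  then show False using c unfolding realizable_def by blast
qed

lemma proper_subset: "proper_edge_coloring F k c \<Longrightarrow> F' \<subseteq> F \<Longrightarrow> proper_edge_coloring F' k c"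
  unfolding proper_edge_coloring_def by blast

end

section \<open>Reducible configurations\<close>

text \<open>In the repeated variants two of the colours named by the configuration coincide. The last row
  is the starting position; the earlier ones are refuted first and then serve as targets.\<close>

lemma path_check_repeated:
  "check [(0, 1), (1, 2), (2, 3)] [] (rows 4
   [(False, [2, 5, 0])])"
  by code_simp

lemma path_check:
  "check [(0, 1), (1, 2), (2, 3)] [] (rows 4
   [(False, [2, 5, 0, 14]),
    (False, [6, 13, 0, 2]),
    (False, [5, 8, 2, 6])])"
  by code_simp

lemma square_check_repeated:
  "check [(0, 1), (1, 2), (1, 3), (2, 4), (3, 4)] [] (rows 5
   [(False, [0, 13, 0])])"
  by code_simp

lemma square_check:
  "check [(0, 1), (1, 2), (1, 3), (2, 4), (3, 4)] [] (rows 5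
   [(False, [13, 18, 0, 12]),
    (True, [0, 13, 6, 24])])"
  by code_simp

lemma tail_check_repeated:
  "check [(0, 1), (1, 2), (1, 3), (2, 4), (3, 4), (4, 5)] [] (rows 6
   [(False, [0, 13, 30, 32, 62]),
    (False, [14, 29, 0, 32, 62]),
    (False, [30, 61, 0, 14, 32]),
    (False, [29, 32, 14, 30, 32]),
    (False, [13, 30, 30, 32, 32])])"
  by code_simp

lemma tail_check:
  "check [(0, 1), (1, 2), (1, 3), (2, 4), (3, 4), (4, 5)] [] (rows 6
   [(False, [2, 13, 0, 60, 62, 62]),
    (False, [13, 50, 0, 12, 62, 62]),
    (False, [2, 12, 1, 60, 62, 62]),
    (False, [2, 12, 28, 33, 62, 62]),
    (False, [2, 13, 30, 32, 60, 62]),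
    (False, [2, 45, 28, 30, 32, 62]),
    (False, [3, 12, 28, 32, 62, 62]),
    (False, [28, 34, 1, 12, 62, 62]),
    (False, [2, 29, 12, 32, 62, 62]),
    (False, [0, 35, 12, 28, 62, 62]),
    (True, [2, 12, 30, 61, 32, 62]),
    (False, [13, 34, 0, 28, 62, 62]),
    (False, [29, 44, 2, 30, 32, 62]),
    (True, [0, 13, 24, 38, 62, 62]),
    (True, [8, 38, 16, 45, 30, 62]),
    (False, [8, 29, 0, 38, 62, 62]),
    (False, [30, 61, 0, 8, 38, 62]),
    (False, [29, 32, 8, 30, 38, 62]),
    (False, [13, 24, 30, 32, 38, 62]),
    (False, [14, 29, 24, 32, 38, 62]),
    (False, [30, 61, 14, 24, 32, 38]),
    (False, [29, 56, 14, 30, 32, 38]),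
    (False, [13, 30, 30, 32, 38, 56])])"
  by code_simp

context critical_graph
begin

text \<open>Reducibility of the path \<open>r\<close>, \<open>s\<close>, \<open>u\<close>,
  \<open>v\<close>. In its application \<open>u\<close> is a common neighbour of \<open>s\<close>
  and \<open>v\<close> along colours missing at \<open>r\<close>.\<close>

lemma no_path:
  assumes F: "{r, s} \<in> E" "F = E - {{r, s}}" "proper_edge_coloring F k c"
    and edges: "{s, u} \<in> F" "{u, v} \<in> F" "r \<noteq> s" "r \<noteq> u" "r \<noteq> v" "s \<noteq> u" "s \<noteq> v" "u \<noteq> v"
    and s: "x < k" "\<not> sees F c s x"
    and r: "\<not> sees F c r (c {s, u})" "\<not> sees F c r (c {u, v})" "\<not> sees F c r g"
    and v: "\<not> sees F c v x" "\<not> sees F c v g" and g: "g < k" "g \<noteq> x"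
  shows False
proof -
  let ?L = "{{r, s}, {s, u}, {u, v}}"
  define a b where "a = c {s, u}" and "b = c {u, v}"
  have sub: "E - ?L \<subseteq> F" using F by blast
  have c': "proper_edge_coloring (E - ?L) k c" by (rule proper_subset[OF F(3) sub])
  have lt: "a < k" "b < k" using F(3) edges unfolding a_def b_def proper_edge_coloring_def by auto
  have ne: "{s, u} \<noteq> {u, v}" using edges by (auto simp: doubleton_eq_iff)
  have ab: "a \<noteq> b" using proper_unique[OF F(3) edges(1,2), of u] ne unfolding a_def b_def by auto
  have seen: "sees F c s a" "sees F c u a" "sees F c u b" "sees F c v b"
    using edges unfolding a_def b_def sees_def by blast+
  have dist: "a \<noteq> x" "b \<noteq> x" "b \<noteq> g" using seen s(2) v by metis+
  have un: "\<not> sees (E - ?L) c s a" "\<not> sees (E - ?L) c u a" "\<not> sees (E - ?L) c u b" "\<not> sees (E - ?L) c v b"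
    unfolding a_def b_def
    by (rule not_sees_removed[OF F(3)]; use edges F in auto)+
  have mono: "\<not> sees F c w y \<Longrightarrow> \<not> sees (E - ?L) c w y" for w y
    using sees_mono[OF _ sub] by blast
  note un' = un mono[OF s(2)] mono[OF r(1)] mono[OF r(2)] mono[OF r(3)] mono[OF v(1)] mono[OF v(2)]
  note un'' = un'[folded a_def b_def]
  have vs: "distinct [r, s, u, v]" using edges by simp
  have L: "(\<lambda>(i, j). {[r, s, u, v] ! i, [r, s, u, v] ! j}) ` set [(0, 1), (1, 2), (2, 3)] = ?L"
    by (simp add: eval_nat_numeral)
  have LE: "?L \<subseteq> E" using F edges by auto
  show False
  \<comment> \<open>\<open>g\<close> is not \<open>b\<close>, which \<open>v\<close> sees, but may
    be \<open>a\<close>. Bits follow the order \<open>r\<close>, \<open>s\<close>, \<open>u\<close>,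
    \<open>v\<close>: the column 5 marks \<open>r\<close> and \<open>u\<close> for the colour
    \<open>x\<close>, which is missing at \<open>s\<close> and \<open>v\<close>.\<close>
  proof (cases "g = a")
    case True
    show False
      by (rule no_realization[OF path_check_repeated _ _ vs _ L LE c',
            where xs = "[x, a, b]" and p = "(False, map (bits 4) [2, 5, 0])" and
              ms = "[[True, False, True, False], [False, False, False, False], [False, True, False, False]]"])
        (use un'' True lt s dist ab in \<open>auto simp: rows_def covers_iff numeral_eq_Suc\<close>)
  next
    case False
    show False
      by (rule no_realization[OF path_check _ _ vs _ L LE c',
            where xs = "[x, a, b, g]" and p = "(False, map (bits 4) [5, 8, 2, 6])" and
              ms = "[[True, False, True, False], [False, False, False, True],
                     [False, True, False, False], [False, True, True, False]]"])
        (use un'' False g lt s dist ab in \<open>auto simp: rows_def covers_iff numeral_eq_Suc\<close>)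
  qed
qed

text \<open>A four-cycle \<open>s\<close>, \<open>u\<close>, \<open>v\<close>, \<open>w\<close>
  whose opposite edges \<open>sw\<close> and \<open>uv\<close> share a colour. Uncolouring the cycle
  leaves this colour missing at all five vertices, hence the column 0.\<close>

lemma no_square:
  assumes F: "{r, s} \<in> E" "F = E - {{r, s}}" "proper_edge_coloring F k c"
    and edges: "{s, u} \<in> F" "{u, v} \<in> F" "{s, w} \<in> F" "{w, v} \<in> F"
    and vs: "distinct [r, s, u, w, v]" and eq: "c {s, w} = c {u, v}"
    and s: "x < k" "\<not> sees F c s x" and v: "\<not> sees F c v x"
    and r: "\<not> sees F c r (c {s, u})" "\<not> sees F c r (c {u, v})" "\<not> sees F c r (c {w, v})"
  shows False
proof -
  let ?L = "{{r, s}, {s, u}, {s, w}, {u, v}, {w, v}}"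
  define a b d where "a = c {s, u}" and "b = c {u, v}" and "d = c {w, v}"
  have bw: "c {s, w} = b" using eq unfolding b_def by simp
  have sub: "E - ?L \<subseteq> F" using F by blast
  have c': "proper_edge_coloring (E - ?L) k c" by (rule proper_subset[OF F(3) sub])
  have lt: "a < k" "b < k" "d < k"
    using F(3) edges unfolding a_def b_def d_def proper_edge_coloring_def by auto
  have "{s, u} \<noteq> {u, v}" "{s, w} \<noteq> {w, v}" using vs by (auto simp: doubleton_eq_iff)
  then have abd: "a \<noteq> b" "b \<noteq> d"
    using proper_unique[OF F(3) edges(1,2), of u] proper_unique[OF F(3) edges(3,4), of w] bw
    unfolding a_def b_def d_def by auto
  have "sees F c s a" "sees F c s b" "sees F c v b" "sees F c v d"
    using edges bw unfolding a_def b_def d_def sees_def by blast+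
  then have dist: "a \<noteq> x" "b \<noteq> x" "d \<noteq> x" using s(2) v by metis+
  have un: "\<not> sees (E - ?L) c s a" "\<not> sees (E - ?L) c u a" "\<not> sees (E - ?L) c u b"
    "\<not> sees (E - ?L) c v b" "\<not> sees (E - ?L) c w d" "\<not> sees (E - ?L) c v d"
    unfolding a_def b_def d_def by (rule not_sees_removed[OF F(3)]; use edges F in auto)+
  have un2: "\<not> sees (E - ?L) c s b" "\<not> sees (E - ?L) c w b"
    unfolding bw[symmetric] by (rule not_sees_removed[OF F(3)]; use edges F in auto)+
  have mono: "\<not> sees F c y z \<Longrightarrow> \<not> sees (E - ?L) c y z" for y z
    using sees_mono[OF _ sub] by blast
  note un' = un un2 mono[OF s(2)] mono[OF r(1), folded a_def] mono[OF r(2), folded b_def]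
    mono[OF r(3), folded d_def] mono[OF v]
  have L: "(\<lambda>(i, j). {[r, s, u, w, v] ! i, [r, s, u, w, v] ! j}) `
      set [(0, 1), (1, 2), (1, 3), (2, 4), (3, 4)] = ?L"
    by (simp add: eval_nat_numeral)
  have LE: "?L \<subseteq> E" using F edges by auto
  show False
  \<comment> \<open>The other two opposite edges may share a colour as well, which merges two
    columns.\<close>
  proof (cases "d = a")
    case True
    show False
      by (rule no_realization[OF square_check_repeated _ _ vs _ L LE c',
            where xs = "[x, a, b]" and p = "(False, map (bits 5) [0, 13, 0])" and
              ms = "map (bits 5) [13, 0, 0]"])
        (use un' True lt s dist abd in \<open>auto simp: rows_def covers_iff numeral_eq_Suc\<close>)
  next
    case False
    show False
      by (rule no_realization[OF square_check _ _ vs _ L LE c',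
            where xs = "[x, a, b, d]" and p = "(True, map (bits 5) [0, 13, 6, 24])" and
              ms = "map (bits 5) [13, 24, 0, 6]"])
        (use un' False lt s dist abd in \<open>auto simp: rows_def covers_iff numeral_eq_Suc\<close>)
  qed
qed

text \<open>The four-cycle \<open>s\<close>, \<open>u\<close>, \<open>y\<close>, \<open>w\<close>
  with a second uncoloured edge \<open>vy\<close> at the vertex opposite to \<open>s\<close>. The
  colours \<open>g\<close> and \<open>h\<close>, missing at \<open>r\<close> and \<open>v\<close>
  and absent from the cycle, contribute the column 30 each.\<close>

lemma no_tail:
  assumes F: "{r, s} \<in> E" "{v, y} \<in> E" "F = E - {{r, s}, {v, y}}" "proper_edge_coloring F k c"
    and edges: "{s, u} \<in> F" "{u, y} \<in> F" "{s, w} \<in> F" "{w, y} \<in> F"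
    and vs: "distinct [r, s, u, w, y, v]" and eq: "c {s, w} = c {u, y}"
    and s: "x < k" "\<not> sees F c s x" and y: "\<not> sees F c y x"
    and r: "\<not> sees F c r (c {s, u})" "\<not> sees F c r (c {u, y})" "\<not> sees F c r (c {w, y})"
      "\<not> sees F c r g" "\<not> sees F c r h"
    and v: "\<not> sees F c v x" "\<not> sees F c v g" "\<not> sees F c v h"
    and gh: "g < k" "h < k" "distinct [x, g, h]"
      "g \<notin> {c {s, u}, c {u, y}, c {w, y}}" "h \<notin> {c {s, u}, c {u, y}, c {w, y}}"
  shows False
proof -
  let ?L = "{{r, s}, {s, u}, {s, w}, {u, y}, {w, y}, {y, v}}"
  define a b d where "a = c {s, u}" and "b = c {u, y}" and "d = c {w, y}"
  have bw: "c {s, w} = b" using eq unfolding b_def by simp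
  have sub: "E - ?L \<subseteq> F" using F by (auto simp: insert_commute)
  have c': "proper_edge_coloring (E - ?L) k c" by (rule proper_subset[OF F(4) sub])
  have lt: "a < k" "b < k" "d < k"
    using F(4) edges unfolding a_def b_def d_def proper_edge_coloring_def by auto
  have "{s, u} \<noteq> {u, y}" "{s, w} \<noteq> {w, y}" using vs by (auto simp: doubleton_eq_iff)
  then have abd: "a \<noteq> b" "b \<noteq> d"
    using proper_unique[OF F(4) edges(1,2), of u] proper_unique[OF F(4) edges(3,4), of w] bw
    unfolding a_def b_def d_def by auto
  have "sees F c s a" "sees F c s b" "sees F c y b" "sees F c y d"
    using edges bw unfolding a_def b_def d_def sees_def by blast+
  then have dist: "a \<noteq> x" "b \<noteq> x" "d \<noteq> x" using s(2) y by metis+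
  have un: "\<not> sees (E - ?L) c s a" "\<not> sees (E - ?L) c u a" "\<not> sees (E - ?L) c u b"
    "\<not> sees (E - ?L) c y b" "\<not> sees (E - ?L) c w d" "\<not> sees (E - ?L) c y d"
    unfolding a_def b_def d_def
    by (rule not_sees_removed[OF F(4)]; use edges F in \<open>auto simp: insert_commute\<close>)+
  have un2: "\<not> sees (E - ?L) c s b" "\<not> sees (E - ?L) c w b"
    unfolding bw[symmetric]
    by (rule not_sees_removed[OF F(4)]; use edges F in \<open>auto simp: insert_commute\<close>)+
  have mono: "\<not> sees F c z' z \<Longrightarrow> \<not> sees (E - ?L) c z' z" for z' z
    using sees_mono[OF _ sub] by blast
  note un' = un un2 mono[OF s(2)] mono[OF r(1), folded a_def] mono[OF r(2), folded b_def]
    mono[OF r(3), folded d_def] mono[OF r(4)] mono[OF r(5)] mono[OF y]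
    mono[OF v(1)] mono[OF v(2)] mono[OF v(3)]
  have gh': "distinct [x, g, h]" "g \<notin> {a, b, d}" "h \<notin> {a, b, d}" 
    using gh unfolding a_def b_def d_def by auto
  have L: "(\<lambda>(i, j). {[r, s, u, w, y, v] ! i, [r, s, u, w, y, v] ! j}) `
      set [(0, 1), (1, 2), (1, 3), (2, 4), (3, 4), (4, 5)] = ?L"
    by (simp add: eval_nat_numeral)
  have LE: "?L \<subseteq> E" using F edges by (auto simp: insert_commute)
  show False
  proof (cases "d = a")
    case True
    show False
      by (rule no_realization[OF tail_check_repeated _ _ vs _ L LE c',
            where xs = "[x, a, b, g, h]" and p = "(False, map (bits 6) [13, 30, 30, 32, 32])" and
              ms = "map (bits 6) [13, 32, 32, 30, 30]"])
        (use un' True lt s dist abd gh' gh(1,2) in \<open>auto simp: rows_def covers_iff numeral_eq_Suc\<close>)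
  next
    case False
    show False
      by (rule no_realization[OF tail_check _ _ vs _ L LE c',
            where xs = "[x, a, b, d, g, h]" and p = "(False, map (bits 6) [13, 30, 30, 32, 38, 56])" and
              ms = "map (bits 6) [13, 56, 32, 38, 30, 30]"])
        (use un' False lt s dist abd gh' gh(1,2) in \<open>auto simp: rows_def covers_iff numeral_eq_Suc\<close>)
  qed
qed

end

section \<open>Colours missing at a vertex of minimum degree\<close>

text \<open>\<open>large\<close> is the degree hypothesis of the theorem multiplied by 3, with
  \<open>r\<close> a vertex of minimum degree.\<close>

locale low_degree_edge = critical_graph +
  fixes r s :: 'a
  assumes rs: "{r, s} \<in> E" "r \<noteq> s"
    and min_r: "\<And>v. v \<in> V \<Longrightarrow> vertex_degree E r \<le> vertex_degree E v"
    and large: "2 * card V + 5 * vertex_degree E r \<le> 3 * k + 7"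
begin

abbreviation F :: "'a set set" where "F \<equiv> E - {{r, s}}"

lemma in_V: "{v, w} \<in> E \<Longrightarrow> v \<in> V"
  using edge[of "{v, w}"] by simp

lemma rs_V: "r \<in> V" "s \<in> V"
  using edge[OF rs(1)] by simp_all

lemma edge_neq: "{v, w} \<in> E \<Longrightarrow> v \<noteq> w"
  using edge[of "{v, w}"] by auto

lemma card_miss_r: "proper_edge_coloring F k c \<Longrightarrow> card (miss F c r) + vertex_degree E r = k + 1"
  using card_miss[of F c r] vertex_degree_delete[OF rs(1), of r] by simp

lemma degree_r: "2 \<le> vertex_degree E r"
  using degree_sum[OF rs(1)] degree_le[OF rs_V(2)] by simp

text \<open>Let \<delta> be the degree of \<open>r\<close>. The set has size \<open>k + 1\<close> -
  \<delta>, so \<open>large\<close> bounds the right side below by \<open>2 * card V\<close> + 2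
  \<delta> - 4, and \<delta> is at least 2.\<close>

lemma many_missing:
  assumes "proper_edge_coloring F k c"
  shows "2 * card V \<le> 3 * card (miss F c r)"
  using card_miss_r[OF assms] large degree_r by linarith

lemma sees_r_or_s: "proper_edge_coloring F k c \<Longrightarrow> z < k \<Longrightarrow> sees F c r z \<or> sees F c s z"
  using sees_either[OF rs(1)] by blast

text \<open>The chain through \<open>s\<close> ends at \<open>r\<close>, so the chain at any third vertex can be swapped.\<close>

lemma swap_at_vertex:
  assumes c: "proper_edge_coloring F k c" and v: "v \<noteq> r" "v \<noteq> s"
    and x: "x < k" "\<not> sees F c s x" and g: "g < k" "\<not> sees F c r g" "\<not> sees F c v g"
  obtains c' where "proper_edge_coloring F k c'" "\<not> sees F c' v x"
    "\<And>z. sees F c' r z \<longleftrightarrow> sees F c r z" "\<And>z. sees F c' s z \<longleftrightarrow> sees F c s z"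
proof (cases "sees F c v x")
  case False
  then show thesis using that c by blast
next
  case True
  have gF: "graph F" by (rule graph) blast
  let ?U = "bicol F c x g"
  have xg: "x \<noteq> g" using True g by blast
  have sat: "saturated ?U (linked ?U `` {w})" for w
    by (rule saturated_linked[OF graph_bicol[OF gF]])
  \<comment> \<open>Otherwise swapping the chain at \<open>s\<close> would leave \<open>g\<close>
    missing at both ends of the uncoloured edge.\<close>
  have sr: "(s, r) \<in> linked ?U"
  proof (rule ccontr)
    assume "(s, r) \<notin> linked ?U"
    then have "\<not> sees F (kempe (linked ?U `` {s}) x g c) r g"
      "\<not> sees F (kempe (linked ?U `` {s}) x g c) s g"
      unfolding kempe_sees[OF sat] using x g xg by auto
    then show False using sees_r_or_s[OF kempe_proper[OF c x(1) g(1) sat] g(1)] by blast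
  qed
  have ends: "sees F c r x" "sees F c s g" using sees_r_or_s[OF c] x g by blast+
  have apart: "(s, v) \<notin> linked ?U"
    using two_ends_bicol[OF gF c xg, of s r v] ends True x g sr v rs(2) by auto
  then have "s \<notin> linked ?U `` {v}" using linked_sym by fast
  moreover have "r \<notin> linked ?U `` {v}" using apart sr linked_trans linked_sym by fast
  ultimately show thesis
    using that[OF kempe_proper[OF c x(1) g(1) sat[of v]]] g
    unfolding kempe_sees[OF sat[of v]] by auto
qed

text \<open>Recolouring \<open>sv\<close> with \<open>x\<close> would free its old colour at
  \<open>s\<close>, and that colour is missing at \<open>r\<close> too.\<close>

lemma no_fan_edge:
  assumes c: "proper_edge_coloring F k c" and x: "x < k" "\<not> sees F c s x" "\<not> sees F c v x"
    and sv: "{s, v} \<in> F" "\<not> sees F c r (c {s, v})"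
  shows False
proof -
  let ?a = "c {s, v}" and ?c = "c({s, v} := x)"
  have "insert {s, v} F = F" using sv by blast
  then have p: "proper_edge_coloring F k ?c" using proper_insert[OF c x] by simp
  have vr: "r \<notin> {s, v}" using sv rs(2) unfolding sees_def by blast
  have xa: "x \<noteq> ?a" using sv(1) x(2) unfolding sees_def by blast
  have "\<not> sees F ?c r ?a" using sv(2) vr unfolding sees_def by auto
  moreover have "\<not> sees F ?c s ?a"
  proof
    assume "sees F ?c s ?a"
    then obtain e where e: "e \<in> F" "s \<in> e" "?c e = ?a" unfolding sees_def by blast
    then have "e \<noteq> {s, v}" using xa by auto
    moreover have "c e = ?a" using e calculation by simp
    ultimately show False using proper_unique[OF c e(1) sv(1) e(2)] by blast
  qed
  moreover have "?a < k" using c sv(1) unfolding proper_edge_coloring_def by blast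
  ultimately show False using sees_r_or_s[OF p] by blast
qed

section \<open>Common neighbours along colours missing at \<open>r\<close>\<close>

lemma nbrs_avoid_r: "{v, u} \<in> F \<Longrightarrow> c {v, u} \<in> miss F c r \<Longrightarrow> u \<noteq> r"
  unfolding miss_def sees_def by blast

lemma nbrs_s: "card (nbrs F c (miss F c r) s) = card (miss F c r)" if "proper_edge_coloring F k c"
proof -
  have "{x \<in> miss F c r. sees F c s x} = miss F c r"
    using sees_r_or_s[OF that] unfolding miss_def by blast
  then show ?thesis using card_nbrs[OF graph that, of "miss F c r" s] by simp
qed

text \<open>The neighbours of \<open>s\<close> and those of \<open>v\<close> along colours missing
  at \<open>r\<close> form disjoint subsets of \<open>V - {r, s, v}\<close>. The second set loses
  one vertex for each of these colours that \<open>v\<close> misses.\<close>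

lemma few_common:
  assumes c: "proper_edge_coloring F k c" and v: "v \<in> V" "v \<noteq> r" "v \<noteq> s"
    and x: "x < k" "\<not> sees F c s x" "\<not> sees F c v x"
  shows "2 * card (miss F c r) + 3 \<le> card V + card (miss F c r \<inter> miss F c v)"
proof -
  let ?R = "miss F c r"
  let ?A = "nbrs F c ?R s" and ?B = "nbrs F c ?R v"
  have AB: "?A \<union> ?B \<subseteq> V - {r, s, v}"
  proof
    fix u assume "u \<in> ?A \<union> ?B"
    then consider "{s, u} \<in> F" "c {s, u} \<in> ?R" | "{v, u} \<in> F" "c {v, u} \<in> ?R"
      unfolding nbrs_def by blast
    then show "u \<in> V - {r, s, v}"
    proof cases
      case 1
      then have "u \<noteq> v" using no_fan_edge[OF c x] unfolding miss_def by blast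
      then show ?thesis using 1 nbrs_avoid_r in_V[of u s] edge_neq[of s u]
        by (auto simp: insert_commute)
    next
      case 2
      then have "u \<noteq> s" using no_fan_edge[OF c x] unfolding miss_def by (auto simp: insert_commute)
      then show ?thesis using 2 nbrs_avoid_r in_V[of u v] edge_neq[of v u]
        by (auto simp: insert_commute)
    qed
  qed
  have fin: "finite ?A" "finite ?B" using AB finite_V finite_subset by (meson Un_subset_iff finite_Diff)+
  have "{r, s, v} \<subseteq> V" "card {r, s, v} = 3" using rs_V v rs(2) by auto
  then have "card (V - {r, s, v}) + 3 = card V"
    using finite_V by (metis card_Diff_subset card_mono finite.emptyI finite_insert le_add_diff_inverse2)
  moreover have "card (?A \<union> ?B) \<le> card (V - {r, s, v})" by (rule card_mono[OF _ AB]) (use finite_V in simp)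
  ultimately have un: "card (?A \<union> ?B) + 3 \<le> card V" by simp
  have "{y \<in> ?R. sees F c v y} = ?R - miss F c v" unfolding miss_def by blast
  then have "card ?B = card (?R - miss F c v)" using card_nbrs[OF graph c, of ?R v] by simp
  then have B: "card ?B + card (?R \<inter> miss F c v) = card ?R"
    using card_Diff_subset_Int[of ?R "miss F c v"] card_mono[of ?R "?R \<inter> miss F c v"] by simp
  have sum: "card ?A + card ?B = card (?A \<union> ?B) + card (?A \<inter> ?B)" by (rule card_Un_Int[OF fin])
  have A: "card ?A = card ?R" by (rule nbrs_s[OF c])
  \<comment> \<open>Given a common neighbour, \<open>no_path\<close> shows that \<open>v\<close>
    misses no colour of \<open>?R\<close>. Then both sets have size \<open>card ?R\<close>, their
    intersection exceeds half of it, and \<open>common_colour\<close> yields the configuration of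
    \<open>no_square\<close>.\<close>
  have "?A \<inter> ?B = {}"
  proof (rule ccontr)
    assume "?A \<inter> ?B \<noteq> {}"
    then obtain u where u: "u \<in> ?A" "u \<in> ?B" by blast
    have "g \<notin> miss F c v" if g: "g \<in> ?R" for g
    proof
      assume gv: "g \<in> miss F c v"
      have "g \<noteq> x" using g gv x sees_r_or_s[OF c] unfolding miss_def by blast
      moreover have "r \<noteq> u" "s \<noteq> u" "u \<noteq> v" using u AB by blast+
      ultimately show False
        using no_path[OF rs(1) refl c, of u v x g] u g gv x v rs(2)
        unfolding nbrs_def miss_def by (auto simp: insert_commute)
    qed
    then have "card (?R \<inter> miss F c v) = 0" by (metis card.empty disjoint_iff)
    then have "card ?R < 2 * card (?A \<inter> ?B)"
      using B A sum un many_missing[OF c] by linarith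
    from common_colour[OF c _ this order_refl]
    obtain u w where uw: "u \<in> ?A \<inter> ?B" "w \<in> ?A \<inter> ?B" "c {s, w} = c {v, u}" by auto
    have "u \<noteq> w"
    proof
      assume "u = w"
      then have "{s, u} = {v, u}"
        using uw proper_unique[OF c, of "{s, u}" "{v, u}" u] unfolding nbrs_def by auto
      then show False using v(3) by (auto simp: doubleton_eq_iff)
    qed
    moreover have "u \<notin> {r, s, v}" "w \<notin> {r, s, v}" using uw AB by blast+
    ultimately show False
      using no_square[OF rs(1) refl c, of u v w x] uw x v rs(2)
      unfolding nbrs_def miss_def by (auto simp: insert_commute)
  qed
  then show ?thesis using B A sum un by simp
qed

text \<open>A swap makes \<open>v\<close> miss \<open>x\<close> while \<open>r\<close> and
  \<open>s\<close> keep their missing colours. Then \<open>few_common\<close> gives many colours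
  missing at both \<open>r\<close> and \<open>v\<close>, and \<open>x\<close>, which
  \<open>r\<close> sees, is one more at \<open>v\<close>.\<close>

lemma small_degree:
  assumes c: "proper_edge_coloring F k c" and v: "v \<in> V" "v \<noteq> r" "v \<noteq> s"
    and x: "x < k" "\<not> sees F c s x" and g: "g = x \<or> g \<in> miss F c r" "\<not> sees F c v g"
  shows "vertex_degree E v + 2 * card (miss F c r) + 4 \<le> k + card V"
proof -
  obtain c' where c': "proper_edge_coloring F k c'" "\<not> sees F c' v x"
    "\<And>z. sees F c' r z \<longleftrightarrow> sees F c r z" "\<And>z. sees F c' s z \<longleftrightarrow> sees F c s z"
    using g swap_at_vertex[OF c v(2,3) x, of g] c unfolding miss_def by blast
  have R: "miss F c' r = miss F c r" using c'(3) unfolding miss_def by simp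
  have "x \<notin> miss F c' r" using x c' sees_r_or_s[OF c'(1)] unfolding miss_def by blast
  moreover have "x \<in> miss F c' v" using x c' unfolding miss_def by blast
  ultimately have "card (miss F c' r \<inter> miss F c' v) < card (miss F c' v)"
    by (intro psubset_card_mono) auto
  moreover have "card (miss F c' v) + vertex_degree E v = k"
    using card_miss[of F c' v] c'(1) vertex_degree_delete'[of v "{r, s}"] v by auto
  moreover have "2 * card (miss F c' r) + 3 \<le> card V + card (miss F c' r \<inter> miss F c' v)"
    using few_common[OF c'(1) v x(1) _ c'(2)] c'(4) x(2) by blast
  ultimately show ?thesis unfolding R by linarith
qed

lemma no_missing_s:
  assumes c: "proper_edge_coloring F k c" and v: "v \<in> V" "v \<noteq> r" "v \<noteq> s"
    and x: "x < k" "\<not> sees F c s x" "\<not> sees F c v x"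
  shows False
proof -
  let ?R = "miss F c r"
  note R_bound = many_missing[OF c] card_miss_r[OF c]
  have M: "2 * card ?R + 3 \<le> card V + card (?R \<inter> miss F c v)" by (rule few_common[OF c v x])
  have dv: "vertex_degree E v + 2 * card ?R + 4 \<le> k + card V"
    using small_degree[OF c v x(1,2), of x] x by blast
  have xR: "x \<notin> ?R" using x sees_r_or_s[OF c] unfolding miss_def by blast
  \<comment> \<open>Otherwise \<open>v\<close> would miss \<open>?R\<close> and also
    \<open>x\<close>, and its degree would be at least two below the minimum.\<close>
  have "\<not> ?R \<subseteq> miss F c v"
  proof
    assume "?R \<subseteq> miss F c v"
    then have "insert x ?R \<subseteq> miss F c v" using x unfolding miss_def by blast
    then have "card (insert x ?R) \<le> card (miss F c v)" by (intro card_mono) simp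
    moreover have "card (miss F c v) + vertex_degree E v = k"
      using card_miss[of F c v] c vertex_degree_delete'[of v "{r, s}"] v by auto
    ultimately show False using xR R_bound(2) min_r[OF v(1)] by simp
  qed
  then obtain t where t: "t \<in> ?R" "sees F c v t" unfolding miss_def by blast
  then obtain e where e: "e \<in> F" "v \<in> e" "c e = t" unfolding sees_def by blast
  obtain y where "e = {v, y}" using graph_edge[OF graph e(1,2)] by blast
  then have vy: "{v, y} \<in> F" "c {v, y} = t" using e by auto
  have yr: "y \<noteq> r" using vy t nbrs_avoid_r by blast
  have ys: "y \<noteq> s"
  proof
    assume "y = s"
    then have "{s, v} \<in> F" "c {s, v} = t" using vy by (simp_all only: insert_commute)
    then show False using no_fan_edge[OF c x] t unfolding miss_def by auto
  qed
  have yv: "y \<noteq> v" using vy edge_neq by blast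
  have yV: "y \<in> V" using vy in_V[of y v] by (auto simp: insert_commute)
  \<comment> \<open>If \<open>y\<close> missed such a colour, it would have small degree like its
    neighbour \<open>v\<close>, and the two degrees could not add up to
    \<open>k + 2\<close>.\<close>
  have y_sees: "sees F c y g" if g: "g = x \<or> g \<in> ?R" for g
  proof (rule ccontr)
    assume "\<not> sees F c y g"
    then have "vertex_degree E y + 2 * card ?R + 4 \<le> k + card V"
      by (rule small_degree[OF c yV yr ys x(1,2) g])
    moreover have "k + 2 \<le> vertex_degree E v + vertex_degree E y" using degree_sum vy by blast
    ultimately show False using dv R_bound large degree_r by linarith
  qed
  define G where "G = E - {{r, s}, {v, y}}"
  have GF: "G = F - {{v, y}}" and gG: "graph G" unfolding G_def by (auto intro: graph)
  have cG: "proper_edge_coloring G k c" by (rule proper_subset[OF c]) (auto simp: GF)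
  have sees_G: "sees G c w z \<longleftrightarrow> sees F c w z" if "w \<notin> {v, y} \<or> z \<noteq> t" for w z
    using that vy unfolding GF sees_def by auto
  have not_t: "\<not> sees G c v t" "\<not> sees G c y t"
    using not_sees_removed[OF c vy(1), of v G] not_sees_removed[OF c vy(1), of y G] vy(2) GF by auto
  have tx: "t < k" "t \<noteq> x" using t xR unfolding miss_def by auto
  let ?U = "bicol G c x t"
  have sat: "saturated ?U (linked ?U `` {w})" for w
    by (rule saturated_linked[OF graph_bicol[OF gG]])
  have ends: "\<not> sees G c s x" "sees G c s t" "sees G c r x" "\<not> sees G c r t" "sees G c y x"
    "\<not> sees G c v x"
    using sees_G[of s x] sees_G[of s t] sees_G[of r x] sees_G[of r t] sees_G[of y x] sees_G[of v x]
      x t tx sees_r_or_s[OF c] v yr ys y_sees[of x] unfolding miss_def by auto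
  \<comment> \<open>Otherwise swapping the chain at \<open>s\<close> would make \<open>t\<close>
    missing at both \<open>s\<close> and \<open>r\<close>. Since \<open>v\<close> misses both
    colours and \<open>y\<close> one of them, \<open>vy\<close> could be coloured again, which gives
    an impossible colouring of \<open>F\<close>.\<close>
  have sr: "(s, r) \<in> linked ?U"
  proof (rule ccontr)
    assume nsr: "(s, r) \<notin> linked ?U"
    define d where "d = kempe (linked ?U `` {s}) x t c"
    note d_sees = kempe_sees[OF sat[of s], folded d_def]
    have d: "proper_edge_coloring G k d"
      unfolding d_def by (rule kempe_proper[OF cG x(1) tx(1) sat])
    have "\<not> sees G d s t" "\<not> sees G d r t" unfolding d_sees using ends nsr tx by auto
    moreover obtain q where q: "q < k" "\<not> sees G d y q" "\<not> sees G d v q"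
    proof (cases "y \<in> linked ?U `` {s}")
      case True
      then have "\<not> sees G d y x" "\<not> sees G d v x" unfolding d_sees using ends not_t tx by auto
      then show thesis using that x(1) by blast
    next
      case False
      then have "\<not> sees G d y t" "\<not> sees G d v t" unfolding d_sees using ends not_t tx by auto
      then show thesis using that tx(1) by blast
    qed
    moreover have "insert {v, y} G = F" using vy GF by blast
    ultimately have p: "proper_edge_coloring F k (d({v, y} := q))"
      and "\<not> sees F (d({v, y} := q)) s t" "\<not> sees F (d({v, y} := q)) r t"
      using proper_insert[OF d q(1), of v y] v yr ys GF unfolding sees_def by auto
    then show False using sees_r_or_s[OF p tx(1)] by blast
  qed
  have sy: "(s, y) \<notin> linked ?U"
    using two_ends_bicol[OF gG cG tx(2)[symmetric], of s r y] ends not_t sr rs(2) yr ys by auto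
  then have far: "s \<notin> linked ?U `` {y}" "r \<notin> linked ?U `` {y}"
    using linked_sym linked_trans sr by fast+
  \<comment> \<open>The chain at \<open>y\<close> avoids \<open>s\<close> and \<open>r\<close>.
    Swapping it makes \<open>y\<close> miss \<open>x\<close> instead of \<open>t\<close>, so that
    \<open>y\<close> sees all of \<open>?R\<close>.\<close>
  define d where "d = kempe (linked ?U `` {y}) x t c"
  note d_sees = kempe_sees[OF sat[of y], folded d_def]
  have d: "proper_edge_coloring G k d"
    unfolding d_def by (rule kempe_proper[OF cG x(1) tx(1) sat])
  have d_s: "sees G d s z \<longleftrightarrow> sees F c s z" and d_r: "sees G d r z \<longleftrightarrow> sees F c r z" for z
    unfolding d_sees using far sees_G v yr ys by auto
  have d_y: "\<not> sees G d y x" and d_v: "\<not> sees G d v x"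
    unfolding d_sees using ends not_t tx by auto
  have d_y_R: "sees G d y z" if "z \<in> ?R" for z
    unfolding d_sees using that ends y_sees[of z] sees_G[of y z] xR by auto
  let ?A = "nbrs G d ?R s" and ?B = "nbrs G d ?R y"
  have "{z \<in> ?R. sees G d s z} = ?R" "{z \<in> ?R. sees G d y z} = ?R"
    using d_y_R d_s sees_r_or_s[OF c] unfolding miss_def by blast+
  then have AB: "card ?A = card ?R" "card ?B = card ?R"
    using card_nbrs[OF gG d, of ?R] by simp_all
  have sub: "?A \<union> ?B \<subseteq> V - {r}"
  proof
    fix u assume "u \<in> ?A \<union> ?B"
    then consider "{s, u} \<in> G" "d {s, u} \<in> ?R" | "{y, u} \<in> G" "d {y, u} \<in> ?R"
      unfolding nbrs_def by blast
    then obtain w where w: "{w, u} \<in> G" "d {w, u} \<in> ?R" by metis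
    have "u \<noteq> r"
    proof
      assume "u = r"
      then have "sees G d r (d {w, u})" using w(1) unfolding sees_def by blast
      then show False using w(2) d_r unfolding miss_def by blast
    qed
    moreover have "u \<in> V" using w in_V[of u w] unfolding G_def by (auto simp: insert_commute)
    ultimately show "u \<in> V - {r}" by blast
  qed
  then have "card (?A \<union> ?B) \<le> card (V - {r})" using finite_V by (intro card_mono) auto
  then have "card (?A \<union> ?B) + 1 \<le> card V"
    using card_Suc_Diff1[OF finite_V rs_V(1)] by linarith
  moreover have "finite ?A" "finite ?B" using sub finite_V finite_subset by (meson Un_subset_iff finite_Diff)+
  ultimately have "2 * card ?R + 1 \<le> card V + card (?A \<inter> ?B)"
    using card_Un_Int[of ?A ?B] AB by linarith
  then have "card ?R < 2 * card (?A \<inter> ?B)" using R_bound large degree_r by linarith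
  from common_colour[OF d _ this order_refl]
  obtain u w where uw: "u \<in> ?A \<inter> ?B" "w \<in> ?A \<inter> ?B" "d {s, w} = d {y, u}" by auto
  have uw_neq: "u \<noteq> w"
  proof
    assume "u = w"
    then have "{s, u} = {y, u}"
      using uw proper_unique[OF d, of "{s, u}" "{y, u}" u] unfolding nbrs_def by auto
    then show False using ys by (auto simp: doubleton_eq_iff)
  qed
  have off: "z \<notin> {r, s, y, v}" if "z \<in> ?A \<inter> ?B" for z
    using that sub edge_neq unfolding nbrs_def G_def by (auto simp: insert_commute)
  have "{r, s, v, y} \<subseteq> V" "card {r, s, v, y} = 4" using rs_V v yV rs(2) yr ys yv by auto
  then have "4 \<le> card V" using card_mono[OF finite_V] by metis
  \<comment> \<open>From \<open>M\<close>, \<open>card V\<close> at least 4 and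
    \<open>3 * card ?R\<close> at least \<open>2 * card V\<close>. The four-cycle uses at most three
    of these colours, which leaves two for \<open>g\<close> and \<open>h\<close>.\<close>
  then have five: "5 \<le> card (?R \<inter> miss F c v)" using M R_bound large degree_r by linarith
  let ?T = "{d {s, u}, d {u, y}, d {w, y}}"
  have "card ?T \<le> 3" by (simp add: card_insert_if)
  then have "2 \<le> card (?R \<inter> miss F c v - ?T)"
    using five diff_card_le_card_Diff[of ?T "?R \<inter> miss F c v"] by simp
  then obtain S where "S \<subseteq> ?R \<inter> miss F c v - ?T" "card S = 2"
    by (rule obtain_subset_with_card_n)
  then obtain g h where gh: "g \<in> ?R \<inter> miss F c v - ?T" "h \<in> ?R \<inter> miss F c v - ?T" "g \<noteq> h"
    unfolding card_2_iff by blast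
  have v_gh: "\<not> sees G d v z" if "z \<in> ?R \<inter> miss F c v" for z
    unfolding d_sees using that ends not_t sees_G[of v z] xR unfolding miss_def by auto
  show False
  proof (rule no_tail[OF rs(1) _ G_def d, of u w x g h])
    show "{v, y} \<in> E" using vy by blast
    show "{s, u} \<in> G" "{u, y} \<in> G" "{s, w} \<in> G" "{w, y} \<in> G" "d {s, w} = d {u, y}"
      using uw unfolding nbrs_def by (auto simp: insert_commute)
    have "u \<notin> {r, s, y, v}" "w \<notin> {r, s, y, v}" using off uw by blast+
    then show "distinct [r, s, u, w, y, v]" using uw_neq rs(2) v yr ys yv by auto
    show "\<not> sees G d s x" using d_s x by blast
    show "\<not> sees G d r (d {s, u})" "\<not> sees G d r (d {u, y})" "\<not> sees G d r (d {w, y})"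
      using uw d_r unfolding nbrs_def miss_def by (auto simp: insert_commute)
    show "\<not> sees G d r g" "\<not> sees G d r h" using gh d_r unfolding miss_def by auto
    show "\<not> sees G d v g" "\<not> sees G d v h" using gh v_gh by auto
    show "g < k" "h < k" using gh unfolding miss_def by auto
    show "distinct [x, g, h]" using gh xR by auto
  qed (use x d_y d_v gh in auto)
qed

text \<open>Some colour \<open>x\<close> is missing at \<open>s\<close>, since \<open>rs\<close> is
  uncoloured. A swap would let \<open>v\<close> miss \<open>x\<close>, against
  \<open>no_missing_s\<close>.\<close>

lemma sees_missing_r:
  assumes c: "proper_edge_coloring F k c" and v: "v \<in> V" "v \<noteq> r"
    and g: "g < k" "\<not> sees F c r g"
  shows "sees F c v g"
proof (rule ccontr)
  assume nv: "\<not> sees F c v g"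
  then have vs: "v \<noteq> s" using sees_r_or_s[OF c] g by blast
  have "0 < card (miss F c s)"
    using card_miss[of F c s] c vertex_degree_delete[OF rs(1), of s] degree_le[OF rs_V(2)] by simp
  then obtain x where x: "x < k" "\<not> sees F c s x" unfolding miss_def by (force simp: card_gt_0_iff)
  obtain c' where "proper_edge_coloring F k c'" "\<not> sees F c' v x"
    "\<And>z. sees F c' s z \<longleftrightarrow> sees F c s z"
    using swap_at_vertex[OF c v(2) vs x g nv] by metis
  then show False using no_missing_s[of c' v x] v vs x by blast
qed

text \<open>Take \<open>g\<close> missing at \<open>r\<close>. All of \<open>r\<close>,
  \<open>v\<close>, \<open>w\<close> are ends of chains in the colours \<open>g\<close> and
  \<open>z\<close>, so \<open>v\<close> or \<open>w\<close> is off the chain of \<open>r\<close>. A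
  swap there makes \<open>g\<close> missing at that vertex as well as at \<open>r\<close>, against
  \<open>sees_missing_r\<close>.\<close>

lemma missed_once:
  assumes c: "proper_edge_coloring F k c" and z: "z < k"
    and v: "v \<in> V" "w \<in> V" "\<not> sees F c v z" "\<not> sees F c w z"
  shows "v = w"
proof (rule ccontr)
  assume vw: "v \<noteq> w"
  have "miss F c r \<noteq> {}"
    using card_miss_r[OF c] degree_le[OF rs_V(1)] by auto
  then obtain g where g: "g < k" "\<not> sees F c r g" unfolding miss_def by blast
  have rz: "sees F c r z"
    using sees_missing_r[OF c _ _ z] v vw by metis
  have vr: "v \<noteq> r" "w \<noteq> r" using rz v by blast+
  have gF: "graph F" by (rule graph) blast
  have gz: "g \<noteq> z" using rz g by blast
  let ?U = "bicol F c g z"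
  have see_g: "sees F c v g" "sees F c w g" using sees_missing_r[OF c _ _ g] v vr by blast+
  have "\<not> ((r, v) \<in> linked ?U \<and> (r, w) \<in> linked ?U)"
    using two_ends_bicol[OF gF c gz, of r v w] g rz see_g v vr vw by auto
  then obtain u where u: "u \<in> V" "u \<noteq> r" "\<not> sees F c u z" "(r, u) \<notin> linked ?U"
    using v vr by blast
  let ?Z = "linked ?U `` {u}"
  have sat: "saturated ?U ?Z" by (rule saturated_linked[OF graph_bicol[OF gF]])
  have "r \<notin> ?Z" using u(4) linked_sym by fast
  then have "\<not> sees F (kempe ?Z g z c) r g" "\<not> sees F (kempe ?Z g z c) u g"
    unfolding kempe_sees[OF sat] using g u(3) by auto
  then show False using sees_missing_r[OF kempe_proper[OF c g(1) z sat] u(1,2) g(1)] by blast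
qed

section \<open>Counting edges by colour classes\<close>

lemma card_colour_class:
  assumes c: "proper_edge_coloring F k c" and z: "z < k"
  shows "card V div 2 \<le> card {e \<in> F. c e = z}"
proof -
  let ?C = "{e \<in> F. c e = z}"
  have disj: "e \<inter> f = {}" if "e \<in> ?C" "f \<in> ?C" "e \<noteq> f" for e f
    using that c unfolding proper_edge_coloring_def by auto
  have two: "finite e \<and> card e = 2" if "e \<in> ?C" for e
    using that edge finite_V finite_subset by blast
  have "card (\<Union>?C) = (\<Sum>e\<in>?C. card e)"
    by (rule card_Union_disjoint) (use disj two in \<open>auto simp: pairwise_def disjnt_def\<close>)
  also have "\<dots> = 2 * card ?C" using two by simp
  finally have un: "card (\<Union>?C) = 2 * card ?C" .
  have sub: "\<Union>?C \<subseteq> V" using edge by blast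
  \<comment> \<open>A vertex outside the matching misses \<open>z\<close>, so there is at most one;
    this accounts for the rounding in \<open>card V div 2\<close>.\<close>
  have "v = w" if "v \<in> V - \<Union>?C" "w \<in> V - \<Union>?C" for v w
    using that missed_once[OF c z, of v w] unfolding sees_def by blast
  then have "card (V - \<Union>?C) \<le> 1"
    using finite_V card_le_Suc0_iff_eq[of "V - \<Union>?C"] by simp
  moreover have "card (V - \<Union>?C) = card V - card (\<Union>?C)"
    by (rule card_Diff_subset[OF finite_subset[OF sub finite_V] sub])
  ultimately show ?thesis unfolding un by linarith
qed

lemma many_edges: "k * (card V div 2) < card E"
proof -
  obtain c where c: "proper_edge_coloring F k c" using deletion[OF rs(1)] by blast
  have fin: "finite F" by (rule finite_edges) blast
  have "k * (card V div 2) = (\<Sum>z<k. card V div 2)" by simp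
  also have "\<dots> \<le> (\<Sum>z<k. card {e \<in> F. c e = z})"
    by (rule sum_mono) (use card_colour_class[OF c] in simp)
  also have "\<dots> = card (\<Union>z\<in>{..<k}. {e \<in> F. c e = z})"
    by (rule card_UN_disjoint[symmetric]) (use fin in auto)
  also have "\<dots> \<le> card F" by (rule card_mono[OF fin]) auto
  also have "\<dots> < card E" by (rule card_Diff1_less[OF finite_edges[OF order_refl] rs(1)])
  finally show ?thesis .
qed

end

section \<open>From the chromatic index to colourings\<close>

lemma ex_proper_coloring:
  assumes "finite E"
  shows "\<exists>c. proper_edge_coloring E (chromatic_index E) c"
proof -
  \<comment> \<open>An injective map to an initial segment of the naturals is a proper colouring, so
    the \<open>LEAST\<close> is attained.\<close>
  obtain f and n :: nat where f: "f ` E = {i. i < n}" "inj_on f E"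
    using finite_imp_inj_to_nat_seg[OF assms] by metis
  have "f e < n" if "e \<in> E" for e using imageI[OF that, of f] f(1) by simp
  then have "proper_edge_coloring E n f"
    using f(2) unfolding proper_edge_coloring_def by (simp add: inj_on_eq_iff)
  then have "\<exists>m c. proper_edge_coloring E m c" by blast
  then show ?thesis unfolding chromatic_index_def by (rule LeastI_ex)
qed

theorem theorem1:
  fixes V :: "'a set" and E :: "'a set set" and n :: nat
  assumes "simple_graph V E" and "connected_graph V E"
    and "n = card V"
    and "delta_critical V E"
    and "real (max_degree V E) - 5 * real (min_degree V E) / 3 \<ge> (2 * real n - 7) / 3"
  shows "overfull V E"
proof -
  let ?k = "max_degree V E"
  have fin: "finite V" and edge: "\<And>e. e \<in> E \<Longrightarrow> e \<subseteq> V \<and> card e = 2"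
    using assms(1) unfolding simple_graph_def by blast+
  have ne: "V \<noteq> {}" using assms(2) unfolding connected_graph_def by blast
  have index: "chromatic_index E = ?k + 1"
    and sub: "\<And>F. F \<subset> E \<Longrightarrow> chromatic_index F < chromatic_index E"
    using assms(1,4) unfolding delta_critical_def proper_subgraph_def simple_graph_def by blast+
  have deg: "vertex_degree E v \<le> ?k" "min_degree V E \<le> vertex_degree E v" if "v \<in> V" for v
    using that fin unfolding max_degree_def min_degree_def by auto
  have finE: "finite E" using edge fin by (meson PowI finite_Pow_iff finite_subset subsetI)
  have mono: "proper_edge_coloring F l c \<Longrightarrow> l \<le> l' \<Longrightarrow> proper_edge_coloring F l' c" for F l l' c
    unfolding proper_edge_coloring_def by fastforce
  interpret critical_graph V E ?k
  proof
    show "\<not> proper_edge_coloring E ?k c" for c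
      using index unfolding chromatic_index_def by (metis Least_le Suc_eq_plus1 not_less_eq_eq order_refl)
    show "\<exists>c. proper_edge_coloring (E - {e}) ?k c" if e: "e \<in> E" for e
    proof -
      have "E - {e} \<subset> E" using e by blast
      then have "chromatic_index (E - {e}) \<le> ?k" using sub[of "E - {e}"] index by simp
      then show ?thesis using ex_proper_coloring[of "E - {e}"] finE mono by blast
    qed
  qed (use fin edge deg in auto)
  have "min_degree V E \<in> vertex_degree E ` V"
    unfolding min_degree_def by (rule Min_in) (use fin ne in auto)
  then obtain r where r: "r \<in> V" "vertex_degree E r = min_degree V E" by auto
  have "E \<noteq> {}"
  proof
    assume "E = {}"
    then have "proper_edge_coloring E 0 (\<lambda>_. 0)" unfolding proper_edge_coloring_def by simp
    then show False using mono uncolourable by blast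
  qed
  \<comment> \<open>Some edge has an end other than \<open>r\<close>, and the first edge of a walk
    from \<open>r\<close> to that end provides \<open>s\<close>.\<close>
  then obtain a where "a \<in> E" by blast
  then obtain b where b: "b \<in> V" "b \<noteq> r" using edge
    by (metis card_2_iff insert_subset)
  have "(r, b) \<in> {(x, y). {x, y} \<in> E}\<^sup>*" using assms(2) r b unfolding connected_graph_def by blast
  then obtain s where s: "{r, s} \<in> E" using b by (auto elim: converse_rtranclE)
  interpret low_degree_edge V E ?k r s
  proof
    show "r \<noteq> s" using s edge by force
    show "2 * card V + 5 * vertex_degree E r \<le> 3 * ?k + 7"
      using assms(3,5) r(2) by (simp add: field_simps)
  qed (use s r deg in auto)
  show ?thesis unfolding overfull_def by (rule many_edges)
qed

end
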